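(* Let the centered stationary Gaussian field $G$ and its covariance $\mathcal C$ satisfy the standing assumptions (stated in the context) for some $\beta>0$. For $f,g\in C^1([0,1])$ let $u_\varepsilon$ be the solution of $$(a(\tfrac{x}{\varepsilon})u_\varepsilon'(x))'=f'(x)\ \text{ on }(0,1),\qquad u_\varepsilon(0)=u_\varepsilon(1)=0,$$ and set $I_\varepsilon(f,g)=\int_0^1u_\varepsilon'(x)g(x)dx$. Then there exists a finite constant $M$, independent of $\varepsilon$, $f$ and $g$, such that for all $\varepsilon\in(0,\frac12]$ $$\mathrm{Var}[I_\varepsilon(f,g)]\le M\,\|f\|_{L^4(0,1)}^2\|g\|_{L^4(0,1)}^2\,\pi_\beta(\varepsilon)^2,$$ where $$\pi_\beta(\varepsilon)^2=\begin{cases}\varepsilon^{\beta}&\text{if }0<\beta<1,\\ \varepsilon|\log\varepsilon|&\text{if }\beta=1,\\ \varepsilon&\text{if }\beta>1.\end{cases}$$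
   Context: Standing assumptions. $G:\mathbb R\to\mathbb R$ is a stationary centered Gaussian random field with covariance function $\mathcal C:\mathbb R\to\mathbb R$, that is, $\mathbb E[G(x)G(y)]=\mathcal C(x-y)$, where $\mathcal C$ is Hölder continuous at zero. For the given $\beta>0$ and a finite constant $K$ one has $|\mathcal C(x)|\le K(1+|x|)^{-\beta}$ for all $x\in\mathbb R$. Moreover $\mathcal C=\mathcal C^\circ\star\mathcal C^\circ$ (convolution) for some $\mathcal C^\circ$ satisfying, for all $x\in\mathbb R$, $\sup_{B(x)}|\mathcal C^\circ|\le K(1+|x|)^{-\frac{1+\beta}{2}}\ell_\beta(x)$, with $\ell_\beta(x)=1$ if $\beta\neq1$ and $\ell_1(x)=\log(2+|x|)^{-1/2}$, where $B(x)$ is the unit ball centered at $x$. Realizations of $G$ are almost surely continuous (continuous version). The random coefficient field is $a(x)=\exp(G(x))$. The solution $u_\varepsilon\in C^1([0,1])$ is random, with $$u_\varepsilon'(x)=\frac{1}{a(x/\varepsilon)}\Big(f(x)-\Big(\int_0^1\frac{1}{a(y/\varepsilon)}dy\Big)^{-1}\int_0^1\frac{f(y)}{a(y/\varepsilon)}dy\Big).$$ *)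

theory Defs
  imports "HOL-Probability.Probability"
begin

text \<open>The centered normal law with standard deviation \<open>\<sigma>\<close>. The case \<open>\<sigma> = 0\<close> is the Dirac
  mass at 0: \<^const>\<open>normal_density\<close> does not cover it, and linear combinations of
  the values of a Gaussian field may be degenerate.\<close>

definition centered_normal_law :: "real \<Rightarrow> real measure" where
  "centered_normal_law \<sigma> =
     (if \<sigma> = 0 then return borel 0 else density lborel (\<lambda>x. ennreal (normal_density 0 \<sigma> x)))"

definition centered_gaussian_field :: "'w measure \<Rightarrow> (real \<Rightarrow> 'w \<Rightarrow> real) \<Rightarrow> bool" where
  "centered_gaussian_field M G \<longleftrightarrow>
     (\<forall>x. G x \<in> borel_measurable M) \<and>
     (\<forall>S c. finite S \<longrightarrow>
        (\<exists>\<sigma>\<ge>0. distr M borel (\<lambda>\<omega>. \<Sum>x\<in>S. c x * G x \<omega>) = centered_normal_law \<sigma>))"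

definition holder_at_zero :: "(real \<Rightarrow> real) \<Rightarrow> bool" where
  "holder_at_zero C \<longleftrightarrow>
     (\<exists>\<gamma> L \<delta>. 0 < \<gamma> \<and> \<gamma> \<le> 1 \<and> 0 < \<delta> \<and> (\<forall>x. \<bar>x\<bar> < \<delta> \<longrightarrow> \<bar>C x - C 0\<bar> \<le> L * \<bar>x\<bar> powr \<gamma>))"

definition convolution_fun :: "(real \<Rightarrow> real) \<Rightarrow> (real \<Rightarrow> real) \<Rightarrow> real \<Rightarrow> real" where
  "convolution_fun h k x = (LINT y|lebesgue. h (x - y) * k y)"

definition log_correction :: "real \<Rightarrow> real \<Rightarrow> real" where
  "log_correction \<beta> x = (if \<beta> = 1 then ln (2 + \<bar>x\<bar>) powr (- 1 / 2) else 1)"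

text \<open>\<open>C\<^sup>1([0,1])\<close>, with one-sided derivatives at the end points, so that the values of the
  function outside \<open>[0,1]\<close> are irrelevant (unlike in \<^const>\<open>C1_differentiable_on\<close>).\<close>

definition C1_unit_interval :: "(real \<Rightarrow> real) \<Rightarrow> bool" where
  "C1_unit_interval h \<longleftrightarrow>
     (\<exists>h'. continuous_on {0..1} h' \<and>
           (\<forall>x\<in>{0..1}. (h has_real_derivative h' x) (at x within {0..1})))"

text \<open>\<open>(A u')' = f'\<close> on \<open>(0,1)\<close> with \<open>u(0) = u(1) = 0\<close> and \<open>u \<in> C\<^sup>1([0,1])\<close>. The coefficient
  \<open>A\<close> is only continuous, so the flux \<open>A u'\<close> is differentiated as a whole. As \<open>f'\<close> is
  continuous, the flux of a weak solution is automatically continuously differentiable.\<close>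

definition dirichlet_solution :: "(real \<Rightarrow> real) \<Rightarrow> (real \<Rightarrow> real) \<Rightarrow> (real \<Rightarrow> real) \<Rightarrow> bool" where
  "dirichlet_solution A f u \<longleftrightarrow>
     C1_unit_interval u \<and>
     (\<forall>x\<in>{0<..<1}. ((\<lambda>y. A y * deriv u y) has_real_derivative deriv f x) (at x)) \<and>
     u 0 = 0 \<and> u 1 = 0"

text \<open>At the end points \<^term>\<open>deriv u\<close> may be unspecified; they form a null set.\<close>

definition I_functional :: "(real \<Rightarrow> real) \<Rightarrow> (real \<Rightarrow> real) \<Rightarrow> real" where
  "I_functional u g = (LINT x:{0..1}|lborel. deriv u x * g x)"

definition L4_norm :: "(real \<Rightarrow> real) \<Rightarrow> real" where
  "L4_norm h = (LINT x:{0..1}|lborel. \<bar>h x\<bar> ^ 4) powr (1 / 4)"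

text \<open>The square \<open>\<pi>\<^sub>\<beta>(\<epsilon>)\<^sup>2\<close> of the rate.\<close>

definition rate_sq :: "real \<Rightarrow> real \<Rightarrow> real" where
  "rate_sq \<beta> \<epsilon> =
     (if \<beta> < 1 then \<epsilon> powr \<beta> else if \<beta> = 1 then \<epsilon> * \<bar>ln \<epsilon>\<bar> else \<epsilon>)"

end

theory Submission
  imports Defs
begin

text \<open>
  Write \<open>b(x) = 1 / a(x/\<epsilon>) = exp (- G(x/\<epsilon>))\<close>. Integrating the equation once gives
  \<open>u' = b (f + c)\<close>, and the boundary values fix the constant \<open>c\<close>, so that
  \<open>I = \<integral> b f g - (\<integral> b f) (\<integral> b g) / \<integral> b\<close> with all integrals over \<open>[0,1]\<close>. This is the total mass of
  \<open>b\<close> times the covariance of \<open>f\<close> and \<open>g\<close> under the random probability measure proportional to \<open>b\<close>.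
  Adding constants to \<open>f\<close> and \<open>g\<close> therefore does not change it, and both may be taken to have mean
  zero; this costs only a constant factor in the \<open>L\<^sup>4\<close> norms.

  Let \<open>m\<close> be the constant mean of \<open>b\<close>, and \<open>A(q) = \<integral> (b - m) q\<close>. For \<open>f\<close> with mean zero,
  \<open>\<integral> b f = A(f)\<close> is itself a fluctuation, and the Cauchy-Schwarz inequalities
  \<open>(\<integral> b g)\<^sup>2 \<le> (\<integral> b) (\<integral> b g\<^sup>2)\<close> and \<open>1 \<le> (\<integral> b) (\<integral> 1/b)\<close> give
  \<open>(I - m \<integral> f g)\<^sup>2 \<le> 2 A(f g)\<^sup>2 + 2 A(f)\<^sup>2 (\<integral> b g\<^sup>2) (\<integral> 1/b)\<close>.
  The random denominator has disappeared: the expectation of the right-hand side is a multiple integral of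
  the moments \<open>E[(b(x) - m) (b(y) - m) b(w) / b(z)]\<close>. For a Gaussian field these are explicit
  exponentials of covariances. They are bounded by a constant times
  \<open>|R(x,y)| + |R(x,w) - R(x,z)|\<close> with \<open>R(x,y) = C((x-y)/\<epsilon>)\<close>, because the tilt by \<open>b(w) / b(z)\<close> only
  shifts the mean of \<open>G(x/\<epsilon>)\<close> by \<open>R(x,z) - R(x,w)\<close>.

  What remains is deterministic. If \<open>\<kappa>\<close> bounds the integral of \<open>|R(x,y)|\<close> over \<open>x\<close>, then Schur's test
  bounds every double integral \<open>\<integral>\<integral> |p(x) q(y) R(x,y)|\<close> by \<open>\<kappa>\<close> times the product of the \<open>L\<^sup>2\<close> norms. With \<open>p\<close> and
  \<open>q\<close> equal to \<open>f\<^sup>2\<close> and \<open>g\<^sup>2\<close> this is where the \<open>L\<^sup>4\<close> norms come from. Finally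
  the decay of \<open>C\<close> makes \<open>\<kappa>\<close> a multiple of \<open>\<integral> (1 + t/\<epsilon>)\<^sup>-\<^sup>\<beta> dt\<close> over \<open>[0,1]\<close>, which is of the order of the rate.

  The moments are computed in \<open>weighted_covariance\<close>, the expectation of the second term is bounded
  in \<open>weighted_product_bound\<close>, and \<open>weighted_cov_variance\<close> is the estimate for a general log-normal weight.
\<close>

section \<open>Bounded functions and interchange of integrals\<close>

lemma Cauchy_Schwarz_integral:
  fixes f g :: "'a \<Rightarrow> real"
  assumes f: "integrable M (\<lambda>x. (f x)\<^sup>2)" and g: "integrable M (\<lambda>x. (g x)\<^sup>2)"
    and fg: "integrable M (\<lambda>x. f x * g x)"
  shows "(\<integral>x. f x * g x \<partial>M)\<^sup>2 \<le> (\<integral>x. (f x)\<^sup>2 \<partial>M) * (\<integral>x. (g x)\<^sup>2 \<partial>M)"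
proof -
  define F H E where "F = (\<integral>x. (f x)\<^sup>2 \<partial>M)" and "H = (\<integral>x. f x * g x \<partial>M)" and "E = (\<integral>x. (g x)\<^sup>2 \<partial>M)"
  have quadratic: "0 \<le> F + 2 * t * H + t\<^sup>2 * E" for t
  proof -
    have "0 \<le> (\<integral>x. (f x + t * g x)\<^sup>2 \<partial>M)" by simp
    also have "\<dots> = (\<integral>x. (f x)\<^sup>2 + (2 * t) * (f x * g x) + t\<^sup>2 * (g x)\<^sup>2 \<partial>M)"
      by (simp add: power2_eq_square algebra_simps)
    also have "\<dots> = F + 2 * t * H + t\<^sup>2 * E"
      using f g fg by (simp add: F_def H_def E_def)
    finally show ?thesis .
  qed
  have "E \<ge> 0" by (simp add: E_def)
  have "H\<^sup>2 \<le> F * E"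
  proof (cases "E = 0")
    case True
    have "H = 0"
    proof (rule ccontr)
      assume "H \<noteq> 0"
      with quadratic[of "- (F + 1) / (2 * H)"] True show False by (simp add: field_simps)
    qed
    then show ?thesis using True by simp
  next
    case False
    with \<open>E \<ge> 0\<close> have "E > 0" by simp
    with quadratic[of "- H / E"] show ?thesis
      by (simp add: field_simps power2_eq_square)
  qed
  then show ?thesis by (simp add: F_def H_def E_def)
qed

text \<open>Fubini's theorem in the form in which it is used below: the moments are known pointwise in the
  parameter \<open>p\<close>, and a uniform bound on them gives joint integrability for free.\<close>

lemma (in prob_space) Fubini_uniform_bound:
  fixes F :: "'b \<times> 'a \<Rightarrow> real"
  assumes "finite_measure N" and meas[measurable]: "F \<in> borel_measurable (N \<Otimes>\<^sub>M M)"
    and int: "\<And>p. p \<in> space N \<Longrightarrow> integrable M (\<lambda>\<omega>. F (p, \<omega>))"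
    and bnd: "\<And>p. p \<in> space N \<Longrightarrow> (\<integral>\<omega>. \<bar>F (p, \<omega>)\<bar> \<partial>M) \<le> B"
  shows "integrable M (\<lambda>\<omega>. \<integral>p. F (p, \<omega>) \<partial>N)"
    and "(\<integral>\<omega>. (\<integral>p. F (p, \<omega>) \<partial>N) \<partial>M) = (\<integral>p. (\<integral>\<omega>. F (p, \<omega>) \<partial>M) \<partial>N)"
    and "integrable N (\<lambda>p. \<integral>\<omega>. F (p, \<omega>) \<partial>M)"
proof -
  interpret N: finite_measure N by fact
  interpret NM: pair_sigma_finite N M ..
  have "integrable N (\<lambda>p. \<integral>\<omega>. norm (F (p, \<omega>)) \<partial>M)"
    by (rule N.integrable_const_bound[where B = B]) (use bnd in auto)
  then have i: "integrable (N \<Otimes>\<^sub>M M) F"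
    using int by (intro NM.Fubini_integrable AE_I2) auto
  then have i': "integrable (N \<Otimes>\<^sub>M M) (case_prod (\<lambda>p \<omega>. F (p, \<omega>)))" by simp
  show "integrable M (\<lambda>\<omega>. \<integral>p. F (p, \<omega>) \<partial>N)"
    using NM.integrable_snd[OF i'] by simp
  show "integrable N (\<lambda>p. \<integral>\<omega>. F (p, \<omega>) \<partial>M)"
    using NM.integrable_fst[OF i'] by simp
  show "(\<integral>\<omega>. (\<integral>p. F (p, \<omega>) \<partial>N) \<partial>M) = (\<integral>p. (\<integral>\<omega>. F (p, \<omega>) \<partial>M) \<partial>N)"
    using NM.integral_fst[OF i'] NM.integral_snd[OF i'] by simp
qed

text \<open>The bound is required everywhere, not almost everywhere: it then survives composition with
  projections of a product space and products, and all integrability questions become a matter of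
  closure rules.\<close>

definition bounded_mble :: "'a measure \<Rightarrow> ('a \<Rightarrow> real) \<Rightarrow> bool" where
  "bounded_mble M f \<longleftrightarrow> f \<in> borel_measurable M \<and> (\<exists>B. \<forall>x. \<bar>f x\<bar> \<le> B)"

lemma bounded_mbleI: "f \<in> borel_measurable M \<Longrightarrow> (\<And>x. \<bar>f x\<bar> \<le> B) \<Longrightarrow> bounded_mble M f"
  by (auto simp: bounded_mble_def)

lemma bounded_mble_measurable: "bounded_mble M f \<Longrightarrow> f \<in> borel_measurable M"
  by (simp add: bounded_mble_def)

lemma bounded_mble_bound:
  assumes "bounded_mble M f" obtains B where "B \<ge> 0" "\<And>x. \<bar>f x\<bar> \<le> B"
proof -
  obtain B where "\<And>x. \<bar>f x\<bar> \<le> B" using assms by (auto simp: bounded_mble_def)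
  moreover from this have "B \<ge> 0" using abs_ge_zero order_trans by blast
  ultimately show ?thesis using that by blast
qed

lemma bounded_mble_const: "bounded_mble M (\<lambda>_. c)"
  by (auto simp: bounded_mble_def)

lemma bounded_mble_add:
  assumes "bounded_mble M f" "bounded_mble M g" shows "bounded_mble M (\<lambda>x. f x + g x)"
proof -
  from assms obtain A B where "\<And>x. \<bar>f x\<bar> \<le> A" "\<And>x. \<bar>g x\<bar> \<le> B" by (auto simp: bounded_mble_def)
  then have "\<bar>f x + g x\<bar> \<le> A + B" for x by (meson abs_triangle_ineq add_mono order_trans)
  then show ?thesis using assms by (auto simp: bounded_mble_def)
qed

lemma bounded_mble_mult:
  assumes "bounded_mble M f" "bounded_mble M g" shows "bounded_mble M (\<lambda>x. f x * g x)"
proof -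
  obtain A where "A \<ge> 0" "\<And>x. \<bar>f x\<bar> \<le> A" using bounded_mble_bound[OF assms(1)] by blast
  moreover obtain B where "B \<ge> 0" "\<And>x. \<bar>g x\<bar> \<le> B" using bounded_mble_bound[OF assms(2)] by blast
  ultimately have "\<bar>f x * g x\<bar> \<le> A * B" for x by (simp add: abs_mult mult_mono)
  then show ?thesis using assms by (auto simp: bounded_mble_def)
qed

lemma bounded_mble_diff:
  assumes "bounded_mble M f" "bounded_mble M g" shows "bounded_mble M (\<lambda>x. f x - g x)"
  using bounded_mble_add[OF assms(1) bounded_mble_mult[OF bounded_mble_const[of _ "-1"] assms(2)]] by simp

lemma bounded_mble_abs: "bounded_mble M f \<Longrightarrow> bounded_mble M (\<lambda>x. \<bar>f x\<bar>)"
  by (auto simp: bounded_mble_def)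

lemma bounded_mble_power: "bounded_mble M f \<Longrightarrow> bounded_mble M (\<lambda>x. f x ^ n)"
  by (induction n) (auto intro: bounded_mble_const bounded_mble_mult)

lemma bounded_mble_sqrt:
  assumes "bounded_mble M f" shows "bounded_mble M (\<lambda>x. sqrt \<bar>f x\<bar>)"
proof -
  obtain A where "A \<ge> 0" "\<And>x. \<bar>f x\<bar> \<le> A" using bounded_mble_bound[OF assms(1)] by blast
  then have "\<bar>sqrt \<bar>f x\<bar>\<bar> \<le> sqrt A" for x by simp
  moreover have "f \<in> borel_measurable M" using assms by (rule bounded_mble_measurable)
  ultimately show ?thesis by (intro bounded_mbleI[where B = "sqrt A"]) auto
qed

lemma bounded_mble_compose: 
  "bounded_mble M f \<Longrightarrow> h \<in> measurable N M \<Longrightarrow> bounded_mble N (\<lambda>x. f (h x))"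
  by (auto simp: bounded_mble_def intro: measurable_compose)

lemmas bounded_mble_intros = bounded_mble_const bounded_mble_add bounded_mble_mult
  bounded_mble_diff bounded_mble_abs bounded_mble_power bounded_mble_sqrt

lemma (in finite_measure) integrable_bounded_mble:
  assumes "bounded_mble M f" shows "integrable M f"
proof -
  obtain B where "\<And>x. \<bar>f x\<bar> \<le> B" using bounded_mble_bound[OF assms] by blast
  then show ?thesis
    using bounded_mble_measurable[OF assms] by (intro integrable_const_bound[where B = B]) auto
qed

lemma (in finite_measure) Cauchy_Schwarz_bounded:
  assumes "bounded_mble M f" "bounded_mble M g"
  shows "(\<integral>x. f x * g x \<partial>M)\<^sup>2 \<le> (\<integral>x. (f x)\<^sup>2 \<partial>M) * (\<integral>x. (g x)\<^sup>2 \<partial>M)"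
  by (intro Cauchy_Schwarz_integral integrable_bounded_mble bounded_mble_intros assms)

lemma power4_add_le: "(u + v) ^ 4 \<le> 8 * (u ^ 4 + v ^ 4)" for u v :: real
proof -
  have sq: "(x + y)\<^sup>2 \<le> 2 * (x\<^sup>2 + y\<^sup>2)" for x y :: real
    using sum_squares_bound[of x y] by (simp add: power2_sum)
  have "(u + v) ^ 4 = ((u + v)\<^sup>2)\<^sup>2" by simp
  also have "\<dots> \<le> (2 * (u\<^sup>2 + v\<^sup>2))\<^sup>2" by (intro power_mono sq) simp
  also have "\<dots> = 4 * (u\<^sup>2 + v\<^sup>2)\<^sup>2" by (simp only: power_mult_distrib) simp
  also have "\<dots> \<le> 4 * (2 * ((u\<^sup>2)\<^sup>2 + (v\<^sup>2)\<^sup>2))" by (intro mult_left_mono sq) simp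
  finally show ?thesis by simp
qed

lemma (in prob_space) square_integral_le:
  assumes "bounded_mble M f"
  shows "(\<integral>x. f x \<partial>M)\<^sup>2 \<le> (\<integral>x. (f x)\<^sup>2 \<partial>M)"
  using Cauchy_Schwarz_bounded[OF assms bounded_mble_const[of _ 1]] by (simp add: prob_space)

lemma (in prob_space) fourth_moment_centered_le:
  assumes f: "bounded_mble M f"
  shows "(\<integral>x. (f x - (\<integral>y. f y \<partial>M)) ^ 4 \<partial>M) \<le> 16 * (\<integral>x. (f x) ^ 4 \<partial>M)"
proof -
  define c where "c = (\<integral>y. f y \<partial>M)"
  have "c ^ 4 = (c\<^sup>2)\<^sup>2" by simp
  also have "\<dots> \<le> (\<integral>x. (f x)\<^sup>2 \<partial>M)\<^sup>2"
    using square_integral_le[OF f] by (intro power_mono) (auto simp: c_def)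
  also have "\<dots> \<le> (\<integral>x. ((f x)\<^sup>2)\<^sup>2 \<partial>M)"
    by (intro square_integral_le bounded_mble_intros f)
  finally have c4: "c ^ 4 \<le> (\<integral>x. (f x) ^ 4 \<partial>M)" by simp
  have i: "integrable M (\<lambda>x. (f x) ^ 4)" "integrable M (\<lambda>x. (f x - c) ^ 4)"
    by (intro integrable_bounded_mble bounded_mble_intros f)+
  have "(\<integral>x. (f x - c) ^ 4 \<partial>M) \<le> (\<integral>x. 8 * ((f x) ^ 4 + c ^ 4) \<partial>M)"
    using i power4_add_le[of "f _" "- c"] by (intro integral_mono) auto
  also have "\<dots> = 8 * ((\<integral>x. (f x) ^ 4 \<partial>M) + c ^ 4)"
    using i by (simp add: prob_space)
  finally show ?thesis using c4 by (simp add: c_def)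
qed

section \<open>Exponential moments of a Gaussian field\<close>

text \<open>Multiplication by the exponential moves the mean of a normal density from \<open>0\<close> to \<open>\<sigma>\<^sup>2\<close> and its mass from
  \<open>1\<close> to \<open>exp (\<sigma>\<^sup>2 / 2)\<close>.\<close>

lemma normal_law_exp_and_square:
  assumes "\<sigma> \<ge> 0"
  shows "has_bochner_integral (centered_normal_law \<sigma>) exp (exp (\<sigma>\<^sup>2 / 2))"
    and "has_bochner_integral (centered_normal_law \<sigma>) (\<lambda>x. x\<^sup>2) (\<sigma>\<^sup>2)"
proof -
  have "has_bochner_integral (centered_normal_law \<sigma>) exp (exp (\<sigma>\<^sup>2 / 2))
      \<and> has_bochner_integral (centered_normal_law \<sigma>) (\<lambda>x. x\<^sup>2) (\<sigma>\<^sup>2)"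
  proof (cases "\<sigma> = 0")
    case True
    interpret prob_space "return borel (0::real)" by (rule prob_space_return) simp
    have "has_bochner_integral (return borel 0) h (h 0)" if "h \<in> borel_measurable borel" for h :: "real \<Rightarrow> real"
    proof -
      have "AE x in return borel 0. h x = h 0"
        using that by (subst AE_return) auto
      then show ?thesis
        using that prob_space
        by (subst has_bochner_integral_cong_AE[where g="\<lambda>_. h 0"])
          (auto simp: has_bochner_integral_iff prob_space)
    qed
    from this[of exp] this[of "\<lambda>x. x\<^sup>2"] show ?thesis using True by (simp add: centered_normal_law_def)
  next
    case False
    with assms have pos: "\<sigma> > 0" by simp
    have tilt: "normal_density 0 \<sigma> x * exp x = exp (\<sigma>\<^sup>2 / 2) * normal_density (\<sigma>\<^sup>2) \<sigma> x" for x
    proof -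
      have "- x\<^sup>2 / (2 * \<sigma>\<^sup>2) + x = \<sigma>\<^sup>2 / 2 - (x - \<sigma>\<^sup>2)\<^sup>2 / (2 * \<sigma>\<^sup>2)"
        using pos by (simp add: field_simps power2_eq_square)
      then have "exp (- x\<^sup>2 / (2 * \<sigma>\<^sup>2)) * exp x = exp (\<sigma>\<^sup>2 / 2) * exp (- (x - \<sigma>\<^sup>2)\<^sup>2 / (2 * \<sigma>\<^sup>2))"
        by (simp flip: exp_add)
      then show ?thesis by (simp add: normal_density_def)
    qed
    have "has_bochner_integral lborel (\<lambda>x. exp (\<sigma>\<^sup>2 / 2) * normal_density (\<sigma>\<^sup>2) \<sigma> x) (exp (\<sigma>\<^sup>2 / 2) * 1)"
      using pos by (intro has_bochner_integral_mult_right)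
        (simp add: has_bochner_integral_iff integrable_normal_density integral_normal_density)
    then have 1: "has_bochner_integral lborel (\<lambda>x. normal_density 0 \<sigma> x *\<^sub>R exp x) (exp (\<sigma>\<^sup>2 / 2))"
      by (simp add: tilt)
    have 2: "has_bochner_integral lborel (\<lambda>x. normal_density 0 \<sigma> x *\<^sub>R x\<^sup>2) (\<sigma>\<^sup>2)"
      using normal_moment_even[OF pos, of 0 1] pos by (simp add: fact_numeral eval_nat_numeral)
    show ?thesis
      using has_bochner_integral_density[OF _ _ _ 1] has_bochner_integral_density[OF _ _ _ 2] False
      by (simp add: centered_normal_law_def)
  qed
  then show "has_bochner_integral (centered_normal_law \<sigma>) exp (exp (\<sigma>\<^sup>2 / 2))"
    and "has_bochner_integral (centered_normal_law \<sigma>) (\<lambda>x. x\<^sup>2) (\<sigma>\<^sup>2)" by auto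
qed

text \<open>The points \<open>p i\<close> may coincide, whereas the definition of a Gaussian field speaks of a set of distinct
  points. Grouping the coefficients by point bridges the two. The variance
  of the combination is then read off from the covariances instead of being tracked through the law.\<close>

lemma gaussian_field_exp_moment:
  assumes G: "centered_gaussian_field P G"
    and cov: "\<And>x y. (\<integral>\<omega>. G x \<omega> * G y \<omega> \<partial>P) = R x y"
    and I: "finite I"
  shows "has_bochner_integral P (\<lambda>\<omega>. exp (\<Sum>i\<in>I. a i * G (p i) \<omega>))
           (exp ((\<Sum>i\<in>I. \<Sum>j\<in>I. a i * a j * R (p i) (p j)) / 2))"
proof -
  have meas[measurable]: "G x \<in> borel_measurable P" for x
    using G by (auto simp: centered_gaussian_field_def)
  have law: "\<exists>\<sigma>\<ge>0. distr P borel (\<lambda>\<omega>. \<Sum>x\<in>S. c x * G x \<omega>) = centered_normal_law \<sigma>" if "finite S" for S c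
    using G that by (auto simp: centered_gaussian_field_def)
  have transfer: "has_bochner_integral P (\<lambda>\<omega>. h (Y \<omega>)) v"
    if "distr P borel Y = centered_normal_law \<sigma>" "has_bochner_integral (centered_normal_law \<sigma>) h v"
      "Y \<in> borel_measurable P" "h \<in> borel_measurable borel"
    for Y :: "_ \<Rightarrow> real" and h :: "real \<Rightarrow> real" and \<sigma> v
    using that by (auto simp: has_bochner_integral_iff integrable_distr_eq integral_distr simp flip: that(1))
  have sq: "integrable P (\<lambda>\<omega>. (G x \<omega>)\<^sup>2)" for x
  proof -
    obtain \<sigma> where "\<sigma> \<ge> 0" "distr P borel (\<lambda>\<omega>. \<Sum>x\<in>{x}. 1 * G x \<omega>) = centered_normal_law \<sigma>"
      using law[of "{x}" "\<lambda>_. 1"] by auto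
    with transfer[OF this(2) normal_law_exp_and_square(2)] show ?thesis
      by (auto simp: has_bochner_integral_iff)
  qed
  have prod_int: "integrable P (\<lambda>\<omega>. G x \<omega> * G y \<omega>)" for x y
  proof (rule Bochner_Integration.integrable_bound)
    show "integrable P (\<lambda>\<omega>. (G x \<omega>)\<^sup>2 + (G y \<omega>)\<^sup>2)" using sq by simp
    have "\<bar>u * v\<bar> \<le> u\<^sup>2 + v\<^sup>2" for u v :: real
      using sum_squares_bound[of u v] sum_squares_bound[of u "- v"] by (auto simp: abs_if)
    then show "AE \<omega> in P. norm (G x \<omega> * G y \<omega>) \<le> norm ((G x \<omega>)\<^sup>2 + (G y \<omega>)\<^sup>2)" by simp
  qed auto
  define Y where "Y \<omega> = (\<Sum>i\<in>I. a i * G (p i) \<omega>)" for \<omega>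
  have [measurable]: "Y \<in> borel_measurable P" unfolding Y_def by measurable
  have "(\<Sum>x\<in>p ` I. (\<Sum>i\<in>{i\<in>I. p i = x}. a i) * G x \<omega>) = Y \<omega>" for \<omega>
  proof -
    have "Y \<omega> = (\<Sum>x\<in>p ` I. \<Sum>i\<in>{i\<in>I. p i = x}. a i * G (p i) \<omega>)"
      unfolding Y_def by (rule sum.image_gen[OF I])
    also have "\<dots> = (\<Sum>x\<in>p ` I. (\<Sum>i\<in>{i\<in>I. p i = x}. a i) * G x \<omega>)"
      by (auto simp: sum_distrib_right intro!: sum.cong)
    finally show ?thesis by simp
  qed
  then obtain \<sigma> where \<sigma>: "\<sigma> \<ge> 0" "distr P borel Y = centered_normal_law \<sigma>"
    using law[of "p ` I" "\<lambda>x. \<Sum>i\<in>{i\<in>I. p i = x}. a i"] I by auto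
  have "\<sigma>\<^sup>2 = (\<integral>\<omega>. (Y \<omega>)\<^sup>2 \<partial>P)"
    using transfer[OF \<sigma>(2) normal_law_exp_and_square(2)[OF \<sigma>(1)]] by (simp add: has_bochner_integral_iff)
  also have "\<dots> = (\<integral>\<omega>. (\<Sum>i\<in>I. \<Sum>j\<in>I. a i * a j * (G (p i) \<omega> * G (p j) \<omega>)) \<partial>P)"
    by (simp add: Y_def power2_eq_square sum_product mult_ac)
  also have "\<dots> = (\<Sum>i\<in>I. \<Sum>j\<in>I. a i * a j * R (p i) (p j))"
    using prod_int by (simp add: cov)
  finally have "\<sigma>\<^sup>2 = (\<Sum>i\<in>I. \<Sum>j\<in>I. a i * a j * R (p i) (p j))" .
  with transfer[OF \<sigma>(2) normal_law_exp_and_square(1)[OF \<sigma>(1)]] show ?thesis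
    by (simp add: Y_def)
qed

section \<open>Moments of a log-normal weight\<close>

lemma abs_exp_minus_one_le: "\<bar>exp t - 1\<bar> \<le> \<bar>t\<bar> * exp \<bar>t\<bar>" for t :: real
proof (cases "t \<ge> 0")
  case True
  have "exp t * (1 - t) \<le> exp t * exp (- t)"
    using exp_ge_add_one_self[of "- t"] by (intro mult_left_mono) auto
  then have "exp t - 1 \<le> t * exp t" by (simp add: exp_minus algebra_simps)
  then show ?thesis using True by simp
next
  case False
  then have "1 - exp t \<le> - t * 1" using exp_ge_add_one_self[of t] by linarith
  also have "\<dots> \<le> - t * exp (- t)" using False by (intro mult_left_mono) auto
  finally show ?thesis using False by simp
qed

text \<open>A Gaussian field \<open>X\<close> with covariance \<open>R\<close>, over an arbitrary probability space \<open>\<nu>\<close> of positions, known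
  only through its exponential moments. The smallness enters through \<open>\<kappa>\<close>, which bounds
  the row integrals of the covariance; \<open>K\<close> is a crude uniform bound that goes into constants.\<close>

locale lognormal_weight = prob_space P + nu: prob_space \<nu>
  for P :: "'w measure" and \<nu> :: "'x measure" +
  fixes X :: "'x \<Rightarrow> 'w \<Rightarrow> real" and R :: "'x \<Rightarrow> 'x \<Rightarrow> real" and s K \<kappa> :: real
  assumes X_joint: "(\<lambda>(x, \<omega>). X x \<omega>) \<in> borel_measurable (\<nu> \<Otimes>\<^sub>M P)"
    and X_bounded: "\<And>\<omega>. \<exists>B. \<forall>x. \<bar>X x \<omega>\<bar> \<le> B"
    and space_nu: "space \<nu> = UNIV"
    and exp_moment: "\<And>(I :: nat set) a p. finite I \<Longrightarrow>
          has_bochner_integral P (\<lambda>\<omega>. exp (\<Sum>i\<in>I. a i * X (p i) \<omega>))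
            (exp ((\<Sum>i\<in>I. \<Sum>j\<in>I. a i * a j * R (p i) (p j)) / 2))"
    and R_joint: "(\<lambda>(x, y). R x y) \<in> borel_measurable (\<nu> \<Otimes>\<^sub>M \<nu>)"
    and R_sym: "\<And>x y. R x y = R y x"
    and R_diag: "\<And>x. R x x = s"
    and R_le: "\<And>x y. \<bar>R x y\<bar> \<le> K"
    and R_int: "\<And>y. (\<integral>x. \<bar>R x y\<bar> \<partial>\<nu>) \<le> \<kappa>"
begin

sublocale nu2: pair_prob_space \<nu> \<nu> ..

definition b :: "'x \<Rightarrow> 'w \<Rightarrow> real" where "b x \<omega> = exp (- X x \<omega>)"

definition m :: real where "m = exp (s / 2)"

lemma b_pos: "b x \<omega> > 0" by (simp add: b_def)

lemma m_pos: "m > 0" by (simp add: m_def)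

lemma b_measurable [measurable (raw)]:
  assumes "h \<in> measurable N \<nu>" "k \<in> measurable N P"
  shows "(\<lambda>t. b (h t) (k t)) \<in> borel_measurable N"
proof -
  have "(\<lambda>t. X (h t) (k t)) \<in> borel_measurable N"
    using measurable_compose[OF measurable_Pair[OF assms] X_joint] by simp
  then show ?thesis unfolding b_def by measurable
qed

lemma R_measurable [measurable (raw)]:
  assumes "h \<in> measurable N \<nu>" "k \<in> measurable N \<nu>"
  shows "(\<lambda>t. R (h t) (k t)) \<in> borel_measurable N"
  using measurable_compose[OF measurable_Pair[OF assms] R_joint] by simp

lemma const_measurable: "(\<lambda>_. x) \<in> measurable N \<nu>"
  by (simp add: space_nu)

lemma K_nonneg: "K \<ge> 0" using R_le abs_ge_zero order_trans by blast

lemma s_le: "\<bar>s\<bar> \<le> K" using R_le R_diag by metis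

lemma \<kappa>_nonneg: "\<kappa> \<ge> 0"
  using R_int[of undefined] by (rule order_trans[rotated]) simp

lemma bounded_b:
  assumes "\<omega> \<in> space P" 
  shows "bounded_mble \<nu> (\<lambda>x. b x \<omega>)" "bounded_mble \<nu> (\<lambda>x. 1 / b x \<omega>)"
proof -
  obtain B where B: "\<And>x. \<bar>X x \<omega>\<bar> \<le> B" using X_bounded[of \<omega>] by blast
  have [measurable]: "(\<lambda>x. b x \<omega>) \<in> borel_measurable \<nu>"
    using assms by measurable
  have "\<bar>b x \<omega>\<bar> \<le> exp B" "\<bar>1 / b x \<omega>\<bar> \<le> exp B" for x 
    using B[of x] by (auto simp: b_def abs_le_iff divide_inverse simp flip: exp_minus)
  then show "bounded_mble \<nu> (\<lambda>x. b x \<omega>)" "bounded_mble \<nu> (\<lambda>x. 1 / b x \<omega>)"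
    by (auto intro!: bounded_mbleI)
qed

lemma bounded_R: "bounded_mble (\<nu> \<Otimes>\<^sub>M \<nu>) (\<lambda>p. R (fst p) (snd p))"
  by (rule bounded_mbleI[where B = K]) (auto simp: R_le)

lemma bounded_R_row: "bounded_mble \<nu> (\<lambda>x. R x y)"
  by (rule bounded_mbleI[where B = K]) (auto simp: R_le intro!: R_measurable const_measurable)

lemma bounded_fst: "bounded_mble \<nu> f \<Longrightarrow> bounded_mble (\<nu> \<Otimes>\<^sub>M \<nu>) (\<lambda>p. f (fst p))"
  by (rule bounded_mble_compose) auto

lemma bounded_snd: "bounded_mble \<nu> f \<Longrightarrow> bounded_mble (\<nu> \<Otimes>\<^sub>M \<nu>) (\<lambda>p. f (snd p))"
  by (rule bounded_mble_compose) auto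

lemmas bounded_intros = bounded_mble_intros bounded_R bounded_R_row bounded_fst bounded_snd

text \<open>With \<open>\<alpha>\<close> and \<open>\<gamma>\<close> ranging over \<open>-1\<close> and \<open>0\<close>, this yields all terms in the expansion of
  \<open>(b(x) - m) (b(y) - m) b(w) / b(z)\<close>.\<close>

lemma four_point_moment:
  "has_bochner_integral P (\<lambda>\<omega>. exp (\<alpha> * X x \<omega> + \<gamma> * X y \<omega>) * (b w \<omega> / b z \<omega>))
     (exp ((\<alpha>\<^sup>2 + \<gamma>\<^sup>2) / 2 * s + \<alpha> * \<gamma> * R x y - \<alpha> * (R x w - R x z) - \<gamma> * (R y w - R y z)
            + s - R w z))"
proof -
  have e: "exp (\<alpha> * X x \<omega> + \<gamma> * X y \<omega>) * (b w \<omega> / b z \<omega>)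
      = exp (\<Sum>i\<in>{0,1,2,3::nat}. [\<alpha>, \<gamma>, -1, 1] ! i * X ([x, y, w, z] ! i) \<omega>)" for \<omega>
    by (simp add: b_def exp_add exp_diff exp_minus field_simps eval_nat_numeral)
  have v: "(\<Sum>i\<in>{0,1,2,3::nat}. \<Sum>j\<in>{0,1,2,3::nat}.
        [\<alpha>, \<gamma>, -1, 1] ! i * [\<alpha>, \<gamma>, -1, 1] ! j * R ([x, y, w, z] ! i) ([x, y, w, z] ! j)) / 2
      = (\<alpha>\<^sup>2 + \<gamma>\<^sup>2) / 2 * s + \<alpha> * \<gamma> * R x y - \<alpha> * (R x w - R x z) - \<gamma> * (R y w - R y z) + s - R w z"
    using R_sym[of y x] R_sym[of w x] R_sym[of w y] R_sym[of z x] R_sym[of z y] R_sym[of z w]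
    by (simp add: R_diag eval_nat_numeral field_simps)
  show ?thesis
    using exp_moment[of "{0,1,2,3}" "(!) [\<alpha>, \<gamma>, -1, 1]" "(!) [x, y, w, z]"]
    unfolding e v[symmetric] by simp
qed

text \<open>All exponents met in the moments below add up to at most \<open>8 K\<close>.\<close>

definition L :: real where "L = 2 * exp (8 * K)"

lemma L_nonneg: "L \<ge> 0" by (simp add: L_def)

text \<open>Set \<open>h = R x w - R x z\<close>, \<open>k = R y w - R y z\<close>, \<open>r = R x y\<close> and \<open>n = E[b(w) / b(z)]\<close>. Relative to the measure
  tilted by \<open>b(w) / b(z)\<close> the means of \<open>b(x)\<close> and \<open>b(y)\<close> are \<open>m e\<^sup>h\<close> and \<open>m e\<^sup>k\<close>, and the expectation equals
  \<open>m\<^sup>2 n (e\<^sup>h\<^sup>+\<^sup>k (e\<^sup>r - 1) + (e\<^sup>h - 1) (e\<^sup>k - 1))\<close>. The first summand is small with \<open>r\<close>; of the second only the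
  factor in \<open>h\<close> is kept, the other one is bounded. This makes the estimate asymmetric in \<open>x\<close> and \<open>y\<close> but
  spares a product of two covariances. At \<open>w = z\<close> the second summand vanishes.\<close>

lemma weighted_covariance:
  fixes x y w z
  defines "F \<equiv> \<lambda>\<omega>. (b x \<omega> - m) * (b y \<omega> - m) * (b w \<omega> / b z \<omega>)"
  shows "integrable P F"
    and "(\<integral>\<omega>. \<bar>F \<omega>\<bar> \<partial>P) \<le> 2 * L"
    and "\<bar>\<integral>\<omega>. F \<omega> \<partial>P\<bar> \<le> L * (\<bar>R x y\<bar> + \<bar>R x w - R x z\<bar>)"
proof -
  define N where "N \<omega> = b w \<omega> / b z \<omega>" for \<omega>
  define h k n where "h = R x w - R x z" and "k = R y w - R y z" and "n = exp (s - R w z)"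
  have e11: "has_bochner_integral P (\<lambda>\<omega>. b x \<omega> * b y \<omega> * N \<omega>) (m\<^sup>2 * n * exp (h + k + R x y))"
    using four_point_moment[of "-1" x "-1" y w z]
    by (simp add: b_def N_def h_def k_def n_def m_def power2_eq_square algebra_simps flip: exp_add)
  have e10: "has_bochner_integral P (\<lambda>\<omega>. b x \<omega> * N \<omega>) (m * n * exp h)"
    using four_point_moment[of "-1" x 0 y w z]
    by (simp add: b_def N_def h_def k_def n_def m_def power2_eq_square algebra_simps flip: exp_add)
  have e01: "has_bochner_integral P (\<lambda>\<omega>. b y \<omega> * N \<omega>) (m * n * exp k)"
    using four_point_moment[of 0 x "-1" y w z]
    by (simp add: b_def N_def h_def k_def n_def m_def power2_eq_square algebra_simps flip: exp_add)
  have e00: "has_bochner_integral P N n"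
    using four_point_moment[of 0 x 0 y w z]
    unfolding N_def by (simp add: n_def)
  note int = e11 e10 e01 e00
  have F: "F = (\<lambda>\<omega>. b x \<omega> * b y \<omega> * N \<omega> - m * (b x \<omega> * N \<omega>) - m * (b y \<omega> * N \<omega>) + m\<^sup>2 * N \<omega>)"
    by (simp add: F_def N_def fun_eq_iff algebra_simps power2_eq_square)
  have EF: "has_bochner_integral P F
      (m\<^sup>2 * n * exp (h + k + R x y) - m * (m * n * exp h) - m * (m * n * exp k) + m\<^sup>2 * n)"
    using int unfolding F has_bochner_integral_iff by simp
  then show int_F: "integrable P F" by (simp add: has_bochner_integral_iff)
  have bnds: "\<bar>R x y\<bar> \<le> K" "\<bar>h\<bar> \<le> 2 * K" "\<bar>k\<bar> \<le> 2 * K" "s \<le> K" "- R w z \<le> K"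
    using R_le[of x y] R_le[of x w] R_le[of x z] R_le[of y w] R_le[of y z] R_le[of w z] s_le
    by (auto simp: h_def k_def)
  have mn: "m\<^sup>2 * n \<le> exp (3 * K)"
    using bnds by (simp add: m_def n_def power2_eq_square flip: exp_add)
  have mn0: "m\<^sup>2 * n \<ge> 0" by (simp add: n_def)
  have "(\<integral>\<omega>. \<bar>F \<omega>\<bar> \<partial>P) \<le> (\<integral>\<omega>. b x \<omega> * b y \<omega> * N \<omega> + m * (b x \<omega> * N \<omega>) + m * (b y \<omega> * N \<omega>) + m\<^sup>2 * N \<omega> \<partial>P)"
  proof (rule integral_mono)
    show "\<bar>F \<omega>\<bar> \<le> b x \<omega> * b y \<omega> * N \<omega> + m * (b x \<omega> * N \<omega>) + m * (b y \<omega> * N \<omega>) + m\<^sup>2 * N \<omega>" for \<omega>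
    proof -
      have pos: "b x \<omega> * b y \<omega> * N \<omega> > 0" "m * (b x \<omega> * N \<omega>) > 0" "m * (b y \<omega> * N \<omega>) > 0" "m\<^sup>2 * N \<omega> > 0"
        using b_pos m_pos by (simp_all add: N_def)
      have "F \<omega> = b x \<omega> * b y \<omega> * N \<omega> - m * (b x \<omega> * N \<omega>) - m * (b y \<omega> * N \<omega>) + m\<^sup>2 * N \<omega>"
        by (simp add: F)
      with pos show ?thesis by linarith
    qed
    show "integrable P (\<lambda>\<omega>. b x \<omega> * b y \<omega> * N \<omega> + m * (b x \<omega> * N \<omega>) + m * (b y \<omega> * N \<omega>) + m\<^sup>2 * N \<omega>)"
      using int by (auto simp: has_bochner_integral_iff)
  qed (use int_F in auto)
  also have "\<dots> = m\<^sup>2 * n * exp (h + k + R x y) + m * (m * n * exp h) + m * (m * n * exp k) + m\<^sup>2 * n"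
    using int by (simp add: has_bochner_integral_iff)
  also have "\<dots> = (m\<^sup>2 * n) * (exp (h + k + R x y) + exp h + exp k + 1)"
    by (simp add: algebra_simps power2_eq_square)
  also have "\<dots> \<le> exp (3 * K) * (exp (5 * K) + exp (5 * K) + exp (5 * K) + exp (5 * K))"
    using bnds K_nonneg by (intro mult_mono mn add_mono) auto
  also have "\<dots> = 2 * L" by (simp add: L_def flip: exp_add)
  finally show "(\<integral>\<omega>. \<bar>F \<omega>\<bar> \<partial>P) \<le> 2 * L" .
  have "(\<integral>\<omega>. F \<omega> \<partial>P) = (m\<^sup>2 * n) * (exp (h + k) * (exp (R x y) - 1) + (exp h - 1) * (exp k - 1))"
    using EF by (simp add: has_bochner_integral_iff exp_add power2_eq_square algebra_simps)
  also have "\<bar>\<dots>\<bar> = (m\<^sup>2 * n) * \<bar>exp (h + k) * (exp (R x y) - 1) + (exp h - 1) * (exp k - 1)\<bar>"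
    unfolding abs_mult[of "m\<^sup>2 * n"] abs_of_nonneg[OF mn0] ..
  also have "\<dots> \<le> (m\<^sup>2 * n) * (exp (h + k) * \<bar>exp (R x y) - 1\<bar> + \<bar>exp h - 1\<bar> * \<bar>exp k - 1\<bar>)"
    by (intro mult_left_mono mn0 order_trans[OF abs_triangle_ineq]) (simp add: abs_mult)
  also have "\<dots> \<le> exp (3 * K) * (exp (4 * K) * (\<bar>R x y\<bar> * exp K) + (\<bar>h\<bar> * exp (2 * K)) * (2 * exp (2 * K)))"
  proof (intro mult_mono add_mono mn)
    show "\<bar>exp (R x y) - 1\<bar> \<le> \<bar>R x y\<bar> * exp K"
      by (rule order_trans[OF abs_exp_minus_one_le]) (use bnds in \<open>auto intro!: mult_left_mono\<close>)
    show "\<bar>exp h - 1\<bar> \<le> \<bar>h\<bar> * exp (2 * K)"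
      by (rule order_trans[OF abs_exp_minus_one_le]) (use bnds in \<open>auto intro!: mult_left_mono\<close>)
    have "exp k \<le> exp (2 * K)" "1 \<le> exp (2 * K)" "exp k > 0" using bnds K_nonneg by auto
    then show "\<bar>exp k - 1\<bar> \<le> 2 * exp (2 * K)" by linarith
  qed (use bnds in auto)
  also have "\<dots> = exp (8 * K) * \<bar>R x y\<bar> + 2 * exp (7 * K) * \<bar>h\<bar>"
    by (simp add: algebra_simps flip: exp_add)
  also have "\<dots> \<le> (2 * exp (8 * K)) * \<bar>R x y\<bar> + 2 * exp (8 * K) * \<bar>h\<bar>"
    using K_nonneg by (intro add_mono mult_right_mono) auto
  finally show "\<bar>\<integral>\<omega>. F \<omega> \<partial>P\<bar> \<le> L * (\<bar>R x y\<bar> + \<bar>R x w - R x z\<bar>)"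
    by (simp add: L_def h_def algebra_simps)
qed

lemma double_integral:
  assumes "bounded_mble (\<nu> \<Otimes>\<^sub>M \<nu>) h"
  shows "(\<integral>p. h p \<partial>(\<nu> \<Otimes>\<^sub>M \<nu>)) = (\<integral>x. \<integral>y. h (x, y) \<partial>\<nu> \<partial>\<nu>)"
    and "(\<integral>p. h p \<partial>(\<nu> \<Otimes>\<^sub>M \<nu>)) = (\<integral>y. \<integral>x. h (x, y) \<partial>\<nu> \<partial>\<nu>)"
proof -
  have i: "integrable (\<nu> \<Otimes>\<^sub>M \<nu>) (case_prod (\<lambda>x y. h (x, y)))"
    using nu2.integrable_bounded_mble[OF assms] by simp
  show "(\<integral>p. h p \<partial>(\<nu> \<Otimes>\<^sub>M \<nu>)) = (\<integral>x. \<integral>y. h (x, y) \<partial>\<nu> \<partial>\<nu>)"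
    using nu2.integral_fst[OF i] by simp
  show "(\<integral>p. h p \<partial>(\<nu> \<Otimes>\<^sub>M \<nu>)) = (\<integral>y. \<integral>x. h (x, y) \<partial>\<nu> \<partial>\<nu>)"
    using nu2.integral_snd[OF i] by simp
qed

lemma integral_product_pair:
  assumes "bounded_mble \<nu> f" "bounded_mble \<nu> g"
  shows "(\<integral>p. f (fst p) * g (snd p) \<partial>(\<nu> \<Otimes>\<^sub>M \<nu>)) = (\<integral>x. f x \<partial>\<nu>) * (\<integral>x. g x \<partial>\<nu>)"
  using assms by (subst double_integral(1)) (auto intro!: bounded_intros)

lemma kernel_row_bound:
  assumes p: "bounded_mble \<nu> p" "\<And>x. p x \<ge> 0"
  shows "(\<integral>z. p (fst z) * \<bar>R (fst z) (snd z)\<bar> \<partial>(\<nu> \<Otimes>\<^sub>M \<nu>)) \<le> \<kappa> * (\<integral>x. p x \<partial>\<nu>)"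
    and "(\<integral>z. p (snd z) * \<bar>R (fst z) (snd z)\<bar> \<partial>(\<nu> \<Otimes>\<^sub>M \<nu>)) \<le> \<kappa> * (\<integral>x. p x \<partial>\<nu>)"
proof -
  have *: "(\<integral>y. p y * (\<integral>x. \<bar>R x y\<bar> \<partial>\<nu>) \<partial>\<nu>) \<le> \<kappa> * (\<integral>x. p x \<partial>\<nu>)"
  proof -
    have b: "bounded_mble \<nu> (\<lambda>y. \<integral>x. \<bar>R x y\<bar> \<partial>\<nu>)"
      using R_int by (intro bounded_mbleI[where B = \<kappa>]) auto
    have "(\<integral>y. p y * (\<integral>x. \<bar>R x y\<bar> \<partial>\<nu>) \<partial>\<nu>) \<le> (\<integral>y. \<kappa> * p y \<partial>\<nu>)"
      using p R_int
      by (intro integral_mono nu.integrable_bounded_mble bounded_intros b)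
        (auto simp: mult.commute[of \<kappa>] intro: mult_left_mono)
    then show ?thesis by simp
  qed
  have "(\<integral>z. p (fst z) * \<bar>R (fst z) (snd z)\<bar> \<partial>(\<nu> \<Otimes>\<^sub>M \<nu>)) = (\<integral>y. p y * (\<integral>x. \<bar>R x y\<bar> \<partial>\<nu>) \<partial>\<nu>)"
    by (subst double_integral(1)) (auto intro!: bounded_intros p simp: R_sym)
  with * show "(\<integral>z. p (fst z) * \<bar>R (fst z) (snd z)\<bar> \<partial>(\<nu> \<Otimes>\<^sub>M \<nu>)) \<le> \<kappa> * (\<integral>x. p x \<partial>\<nu>)" by simp
  have "(\<integral>z. p (snd z) * \<bar>R (fst z) (snd z)\<bar> \<partial>(\<nu> \<Otimes>\<^sub>M \<nu>)) = (\<integral>y. p y * (\<integral>x. \<bar>R x y\<bar> \<partial>\<nu>) \<partial>\<nu>)"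
    by (subst double_integral(2)) (auto intro!: bounded_intros p)
  with * show "(\<integral>z. p (snd z) * \<bar>R (fst z) (snd z)\<bar> \<partial>(\<nu> \<Otimes>\<^sub>M \<nu>)) \<le> \<kappa> * (\<integral>x. p x \<partial>\<nu>)" by simp
qed

text \<open>Cauchy-Schwarz on the product space after splitting \<open>|R|\<close> evenly between the two factors.\<close>

lemma Schur_test:
  assumes p: "bounded_mble \<nu> p" and q: "bounded_mble \<nu> q"
  shows "(\<integral>z. \<bar>p (fst z)\<bar> * \<bar>q (snd z)\<bar> * \<bar>R (fst z) (snd z)\<bar> \<partial>(\<nu> \<Otimes>\<^sub>M \<nu>))
           \<le> \<kappa> * sqrt ((\<integral>x. (p x)\<^sup>2 \<partial>\<nu>) * (\<integral>x. (q x)\<^sup>2 \<partial>\<nu>))" (is "?I \<le> _")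
proof -
  define r where "r z = sqrt \<bar>R (fst z) (snd z)\<bar>" for z
  have r2: "r z * r z = \<bar>R (fst z) (snd z)\<bar>" for z by (simp add: r_def)
  have r2': "(r z)\<^sup>2 = \<bar>R (fst z) (snd z)\<bar>" for z by (simp add: r_def)
  have b: "bounded_mble (\<nu> \<Otimes>\<^sub>M \<nu>) (\<lambda>z. \<bar>p (fst z)\<bar> * r z)" "bounded_mble (\<nu> \<Otimes>\<^sub>M \<nu>) (\<lambda>z. \<bar>q (snd z)\<bar> * r z)"
    unfolding r_def by (intro bounded_intros p q)+
  have "?I = (\<integral>z. (\<bar>p (fst z)\<bar> * r z) * (\<bar>q (snd z)\<bar> * r z) \<partial>(\<nu> \<Otimes>\<^sub>M \<nu>))"
    by (simp add: mult_ac flip: r2)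
  then have "?I\<^sup>2 \<le> (\<integral>z. (\<bar>p (fst z)\<bar> * r z)\<^sup>2 \<partial>(\<nu> \<Otimes>\<^sub>M \<nu>)) * (\<integral>z. (\<bar>q (snd z)\<bar> * r z)\<^sup>2 \<partial>(\<nu> \<Otimes>\<^sub>M \<nu>))"
    using nu2.Cauchy_Schwarz_bounded[OF b] by simp
  also have "\<dots> = (\<integral>z. (p (fst z))\<^sup>2 * \<bar>R (fst z) (snd z)\<bar> \<partial>(\<nu> \<Otimes>\<^sub>M \<nu>)) * (\<integral>z. (q (snd z))\<^sup>2 * \<bar>R (fst z) (snd z)\<bar> \<partial>(\<nu> \<Otimes>\<^sub>M \<nu>))"
    by (simp add: power_mult_distrib r2')
  also have "\<dots> \<le> (\<kappa> * (\<integral>x. (p x)\<^sup>2 \<partial>\<nu>)) * (\<kappa> * (\<integral>x. (q x)\<^sup>2 \<partial>\<nu>))"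
    using \<kappa>_nonneg by (intro mult_mono kernel_row_bound bounded_intros p q) auto
  also have "\<dots> = (\<kappa> * sqrt ((\<integral>x. (p x)\<^sup>2 \<partial>\<nu>) * (\<integral>x. (q x)\<^sup>2 \<partial>\<nu>)))\<^sup>2"
    by (simp add: power_mult_distrib) (simp add: power2_eq_square)
  finally show ?thesis
    using \<kappa>_nonneg by (intro power2_le_imp_le[of ?I]) auto
qed

definition fluct :: "('x \<Rightarrow> real) \<Rightarrow> 'w \<Rightarrow> real" where
  "fluct q \<omega> = (\<integral>x. (b x \<omega> - m) * q x \<partial>\<nu>)"

lemma fluct_measurable [measurable]:
  assumes "bounded_mble \<nu> q" shows "fluct q \<in> borel_measurable P"
proof -
  have [measurable]: "q \<in> borel_measurable \<nu>" using assms by (rule bounded_mble_measurable)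
  show ?thesis unfolding fluct_def by measurable
qed

text \<open>The square of the fluctuation is a double integral, so its tilted expectation is the double
  integral of the moments bounded above. The term \<open>|q(x) q(y)| H(x)\<close> is
  split by the inequality between the arithmetic and the geometric mean, so that only weights \<open>q\<^sup>2\<close> remain.\<close>

lemma tilted_second_moment:
  fixes w z and q
  assumes q: "bounded_mble \<nu> q"
  defines "H \<equiv> \<lambda>x. \<bar>R x w - R x z\<bar>"
  shows "integrable P (\<lambda>\<omega>. (fluct q \<omega>)\<^sup>2 * (b w \<omega> / b z \<omega>))"
    and "(\<integral>\<omega>. (fluct q \<omega>)\<^sup>2 * (b w \<omega> / b z \<omega>) \<partial>P)
      \<le> L * (\<kappa> * (\<integral>x. (q x)\<^sup>2 \<partial>\<nu>) + (\<integral>x. (q x)\<^sup>2 * H x \<partial>\<nu>) / 2 + (\<integral>x. (q x)\<^sup>2 \<partial>\<nu>) * (\<integral>x. H x \<partial>\<nu>) / 2)"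
proof -
  have qm[measurable]: "q \<in> borel_measurable \<nu>" using q by (rule bounded_mble_measurable)
  have wm[measurable]: "(\<lambda>_. w) \<in> measurable N \<nu>" "(\<lambda>_. z) \<in> measurable N \<nu>" for N by (rule const_measurable)+
  have Hb: "bounded_mble \<nu> H" unfolding H_def by (intro bounded_intros)
  define Q where "Q p = q (fst p) * q (snd p)" for p
  have Qb: "bounded_mble (\<nu> \<Otimes>\<^sub>M \<nu>) Q" unfolding Q_def by (intro bounded_intros q)
  have Qm[measurable]: "Q \<in> borel_measurable (\<nu> \<Otimes>\<^sub>M \<nu>)" using Qb by (rule bounded_mble_measurable)
  define C where "C p \<omega> = (b (fst p) \<omega> - m) * (b (snd p) \<omega> - m) * (b w \<omega> / b z \<omega>)" for p \<omega>
  define F where "F = (\<lambda>(p, \<omega>). Q p * C p \<omega>)"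
  obtain B where B: "B \<ge> 0" "\<And>p. \<bar>Q p\<bar> \<le> B" using bounded_mble_bound[OF Qb] by blast
  have Fm: "F \<in> borel_measurable ((\<nu> \<Otimes>\<^sub>M \<nu>) \<Otimes>\<^sub>M P)" 
    unfolding F_def C_def by measurable
  have Fi: "integrable P (\<lambda>\<omega>. F (p, \<omega>))" for p
    unfolding F_def C_def prod.case by (intro integrable_mult_right weighted_covariance(1))
  have Fb: "(\<integral>\<omega>. \<bar>F (p, \<omega>)\<bar> \<partial>P) \<le> B * (2 * L)" for p
  proof -
    have "(\<integral>\<omega>. \<bar>F (p, \<omega>)\<bar> \<partial>P) = \<bar>Q p\<bar> * (\<integral>\<omega>. \<bar>C p \<omega>\<bar> \<partial>P)"
      by (simp add: F_def abs_mult)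
    also have "\<dots> \<le> B * (2 * L)"
      using weighted_covariance(2) B unfolding C_def by (intro mult_mono) auto
    finally show ?thesis .
  qed
  have sq: "(\<integral>p. F (p, \<omega>) \<partial>(\<nu> \<Otimes>\<^sub>M \<nu>)) = (fluct q \<omega>)\<^sup>2 * (b w \<omega> / b z \<omega>)" if "\<omega> \<in> space P" for \<omega>
  proof -
    let ?h = "\<lambda>x. (b x \<omega> - m) * q x"
    have "(\<integral>p. F (p, \<omega>) \<partial>(\<nu> \<Otimes>\<^sub>M \<nu>)) = (\<integral>p. ?h (fst p) * ?h (snd p) * (b w \<omega> / b z \<omega>) \<partial>(\<nu> \<Otimes>\<^sub>M \<nu>))"
      by (simp add: F_def Q_def C_def mult_ac)
    also have "\<dots> = (\<integral>p. ?h (fst p) * ?h (snd p) \<partial>(\<nu> \<Otimes>\<^sub>M \<nu>)) * (b w \<omega> / b z \<omega>)" by (rule integral_mult_left_zero)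
    also have "(\<integral>p. ?h (fst p) * ?h (snd p) \<partial>(\<nu> \<Otimes>\<^sub>M \<nu>)) = (fluct q \<omega>)\<^sup>2"
      by (subst integral_product_pair) (auto intro!: bounded_intros bounded_b that q simp: fluct_def power2_eq_square)
    finally show ?thesis .
  qed
  note Fub = Fubini_uniform_bound[OF nu2.finite_measure_axioms Fm Fi Fb]
  show "integrable P (\<lambda>\<omega>. (fluct q \<omega>)\<^sup>2 * (b w \<omega> / b z \<omega>))"
    using Fub(1) sq by (simp cong: Bochner_Integration.integrable_cong)
  have "(\<integral>\<omega>. (fluct q \<omega>)\<^sup>2 * (b w \<omega> / b z \<omega>) \<partial>P) = (\<integral>p. (\<integral>\<omega>. F (p, \<omega>) \<partial>P) \<partial>(\<nu> \<Otimes>\<^sub>M \<nu>))"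
    using Fub(2) sq by (simp cong: Bochner_Integration.integral_cong)
  also have "\<dots> \<le> (\<integral>p. L * (\<bar>q (fst p)\<bar> * \<bar>q (snd p)\<bar> * \<bar>R (fst p) (snd p)\<bar>
       + ((q (fst p))\<^sup>2 * H (fst p) * 1 + H (fst p) * (q (snd p))\<^sup>2) / 2) \<partial>(\<nu> \<Otimes>\<^sub>M \<nu>))"
  proof (rule integral_mono[OF Fub(3)])
    show "integrable (\<nu> \<Otimes>\<^sub>M \<nu>) (\<lambda>p. L * (\<bar>q (fst p)\<bar> * \<bar>q (snd p)\<bar> * \<bar>R (fst p) (snd p)\<bar>
       + ((q (fst p))\<^sup>2 * H (fst p) * 1 + H (fst p) * (q (snd p))\<^sup>2) / 2))"
      unfolding divide_inverse by (intro nu2.integrable_bounded_mble bounded_intros q Hb)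
    fix p
    let ?a = "\<bar>q (fst p)\<bar>" and ?c = "\<bar>q (snd p)\<bar>"
    have "(\<integral>\<omega>. F (p, \<omega>) \<partial>P) = Q p * (\<integral>\<omega>. C p \<omega> \<partial>P)" by (simp add: F_def)
    also have "\<dots> \<le> \<bar>Q p\<bar> * \<bar>\<integral>\<omega>. C p \<omega> \<partial>P\<bar>" by (metis abs_ge_self abs_mult)
    also have "\<dots> \<le> \<bar>Q p\<bar> * (L * (\<bar>R (fst p) (snd p)\<bar> + H (fst p)))"
      using weighted_covariance(3)[of "fst p" "snd p" w z] by (intro mult_left_mono) (auto simp: C_def H_def)
    also have "\<dots> = L * (?a * ?c * \<bar>R (fst p) (snd p)\<bar> + ?a * ?c * H (fst p))"
      by (simp add: Q_def abs_mult algebra_simps)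
    also have "\<dots> \<le> L * (?a * ?c * \<bar>R (fst p) (snd p)\<bar> + (?a\<^sup>2 + ?c\<^sup>2) / 2 * H (fst p))"
      using sum_squares_bound[of ?a ?c] L_nonneg
      by (intro mult_left_mono add_left_mono mult_right_mono) (auto simp: H_def)
    finally show "(\<integral>\<omega>. F (p, \<omega>) \<partial>P) \<le> L * (?a * ?c * \<bar>R (fst p) (snd p)\<bar>
       + ((q (fst p))\<^sup>2 * H (fst p) * 1 + H (fst p) * (q (snd p))\<^sup>2) / 2)"
      by (simp add: algebra_simps add_divide_distrib)
  qed
  also have "\<dots> = L * ((\<integral>p. \<bar>q (fst p)\<bar> * \<bar>q (snd p)\<bar> * \<bar>R (fst p) (snd p)\<bar> \<partial>(\<nu> \<Otimes>\<^sub>M \<nu>))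
     + ((\<integral>p. (q (fst p))\<^sup>2 * H (fst p) * 1 \<partial>(\<nu> \<Otimes>\<^sub>M \<nu>)) + (\<integral>p. H (fst p) * (q (snd p))\<^sup>2 \<partial>(\<nu> \<Otimes>\<^sub>M \<nu>))) / 2)"
  proof -
    have i: "integrable (\<nu> \<Otimes>\<^sub>M \<nu>) (\<lambda>p. \<bar>q (fst p)\<bar> * \<bar>q (snd p)\<bar> * \<bar>R (fst p) (snd p)\<bar>)"
      "integrable (\<nu> \<Otimes>\<^sub>M \<nu>) (\<lambda>p. (q (fst p))\<^sup>2 * H (fst p) * 1)"
      "integrable (\<nu> \<Otimes>\<^sub>M \<nu>) (\<lambda>p. H (fst p) * (q (snd p))\<^sup>2)"
      by (intro nu2.integrable_bounded_mble bounded_intros q Hb)+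
    show ?thesis using i
      by (simp only: integral_mult_right_zero integral_divide_zero integrable_divide_zero Bochner_Integration.integral_add
          Bochner_Integration.integrable_add)
  qed
  also have "\<dots> \<le> L * (\<kappa> * (\<integral>x. (q x)\<^sup>2 \<partial>\<nu>) + ((\<integral>x. (q x)\<^sup>2 * H x \<partial>\<nu>) + (\<integral>x. H x \<partial>\<nu>) * (\<integral>x. (q x)\<^sup>2 \<partial>\<nu>)) / 2)"
  proof -
    have "(\<integral>p. \<bar>q (fst p)\<bar> * \<bar>q (snd p)\<bar> * \<bar>R (fst p) (snd p)\<bar> \<partial>(\<nu> \<Otimes>\<^sub>M \<nu>)) \<le> \<kappa> * (\<integral>x. (q x)\<^sup>2 \<partial>\<nu>)"
      using Schur_test[OF q q] by simp
    moreover have "(\<integral>p. (q (fst p))\<^sup>2 * H (fst p) * 1 \<partial>(\<nu> \<Otimes>\<^sub>M \<nu>)) = (\<integral>x. (q x)\<^sup>2 * H x \<partial>\<nu>)"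
      by (subst integral_product_pair[where f = "\<lambda>x. (q x)\<^sup>2 * H x" and g = "\<lambda>_. 1"])
        (auto intro!: bounded_intros q Hb simp: nu.prob_space)
    moreover have "(\<integral>p. H (fst p) * (q (snd p))\<^sup>2 \<partial>(\<nu> \<Otimes>\<^sub>M \<nu>)) = (\<integral>x. H x \<partial>\<nu>) * (\<integral>x. (q x)\<^sup>2 \<partial>\<nu>)"
      by (subst integral_product_pair[where f = H and g = "\<lambda>x. (q x)\<^sup>2"]) (auto intro!: bounded_intros q Hb)
    ultimately show ?thesis
      using L_nonneg by (intro mult_left_mono) auto
  qed
  finally show "(\<integral>\<omega>. (fluct q \<omega>)\<^sup>2 * (b w \<omega> / b z \<omega>) \<partial>P)
      \<le> L * (\<kappa> * (\<integral>x. (q x)\<^sup>2 \<partial>\<nu>) + (\<integral>x. (q x)\<^sup>2 * H x \<partial>\<nu>) / 2 + (\<integral>x. (q x)\<^sup>2 \<partial>\<nu>) * (\<integral>x. H x \<partial>\<nu>) / 2)"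
    by (simp add: add_divide_distrib mult_ac add_ac)
qed

lemma fluct_second_moment:
  assumes q: "bounded_mble \<nu> q"
  shows "integrable P (\<lambda>\<omega>. (fluct q \<omega>)\<^sup>2)"
    and "(\<integral>\<omega>. (fluct q \<omega>)\<^sup>2 \<partial>P) \<le> L * \<kappa> * (\<integral>x. (q x)\<^sup>2 \<partial>\<nu>)"
  \<comment> \<open>The two tilting points coincide, so the tilt is trivial and \<open>H\<close> vanishes; any point will do.\<close>
  using tilted_second_moment[OF q, of undefined undefined] b_pos[THEN less_imp_neq, THEN not_sym]
  by simp_all

section \<open>The covariance of two functions under a log-normal weight\<close>

text \<open>The integrals \<open>\<integral> b g\<^sup>2\<close> and \<open>\<integral> 1/b\<close> are unfolded into an integral over \<open>(w, z)\<close> of tilted second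
  moments with weight \<open>g(w)\<^sup>2\<close>. The correlation \<open>R x w\<close> couples the position \<open>x\<close> of \<open>q\<^sup>2\<close> to the position \<open>w\<close>
  of \<open>g\<^sup>2\<close>, and Schur's test for this coupling needs the fourth moments of \<open>q\<close> and \<open>g\<close>.\<close>

lemma weighted_product_bound:
  assumes q: "bounded_mble \<nu> q" and g: "bounded_mble \<nu> g"
  defines "W \<equiv> \<lambda>\<omega>. (fluct q \<omega>)\<^sup>2 * ((\<integral>x. b x \<omega> * (g x)\<^sup>2 \<partial>\<nu>) * (\<integral>x. 1 / b x \<omega> \<partial>\<nu>))"
  shows "integrable P W"
    and "(\<integral>\<omega>. W \<omega> \<partial>P) \<le> 3 * L * \<kappa> * sqrt ((\<integral>x. (q x) ^ 4 \<partial>\<nu>) * (\<integral>x. (g x) ^ 4 \<partial>\<nu>))"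
proof -
  have [measurable]: "q \<in> borel_measurable \<nu>" "g \<in> borel_measurable \<nu>" "fluct q \<in> borel_measurable P"
    using q g by (auto intro: bounded_mble_measurable fluct_measurable)
  define q2 g2 q4 g4 where "q2 = (\<integral>x. (q x)\<^sup>2 \<partial>\<nu>)" and "g2 = (\<integral>x. (g x)\<^sup>2 \<partial>\<nu>)"
    and "q4 = (\<integral>x. (q x) ^ 4 \<partial>\<nu>)" and "g4 = (\<integral>x. (g x) ^ 4 \<partial>\<nu>)"
  have nn: "q2 \<ge> 0" "g2 \<ge> 0" "q4 \<ge> 0" "g4 \<ge> 0" by (auto simp: q2_def g2_def q4_def g4_def)
  have "q2\<^sup>2 \<le> q4" "g2\<^sup>2 \<le> g4"
    using nu.square_integral_le[of "\<lambda>x. (q x)\<^sup>2"] nu.square_integral_le[of "\<lambda>x. (g x)\<^sup>2"] q g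
    by (auto simp: q2_def g2_def q4_def g4_def intro!: bounded_intros)
  then have L2_le_L4: "q2 * g2 \<le> sqrt (q4 * g4)"
    using nn by (auto intro!: real_le_rsqrt mult_mono simp: power_mult_distrib)
  define \<psi> where "\<psi> w = (\<integral>x. (q x)\<^sup>2 * \<bar>R x w\<bar> \<partial>\<nu>)" for w
  have \<psi>_nn: "\<psi> w \<ge> 0" for w by (simp add: \<psi>_def)
  have \<psi>_le: "\<psi> w \<le> K * q2" for w
  proof -
    have "\<psi> w \<le> (\<integral>x. K * (q x)\<^sup>2 \<partial>\<nu>)"
      unfolding \<psi>_def using R_le
      by (intro integral_mono nu.integrable_bounded_mble bounded_intros q)
        (auto simp: mult.commute[of K] intro: mult_left_mono)
    then show ?thesis by (simp add: q2_def)
  qed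
  have \<psi>_b: "bounded_mble \<nu> \<psi>"
  proof (rule bounded_mbleI)
    show "\<psi> \<in> borel_measurable \<nu>" unfolding \<psi>_def by measurable
    show "\<bar>\<psi> w\<bar> \<le> K * q2" for w using \<psi>_nn \<psi>_le by simp
  qed
  define T where "T p = (\<integral>\<omega>. (fluct q \<omega>)\<^sup>2 * (b (fst p) \<omega> / b (snd p) \<omega>) \<partial>P)" for p
  have T_le: "T p \<le> L * (2 * \<kappa> * q2 + (\<psi> (fst p) + \<psi> (snd p)) / 2)" for p
  proof -
    let ?w = "fst p" and ?z = "snd p"
    define H where "H x = \<bar>R x ?w - R x ?z\<bar>" for x
    have H_le: "H x \<le> \<bar>R x ?w\<bar> + \<bar>R x ?z\<bar>" for x by (simp add: H_def)
    have Hb: "bounded_mble \<nu> H" unfolding H_def by (intro bounded_intros)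
    have "(\<integral>x. (q x)\<^sup>2 * H x \<partial>\<nu>) \<le> (\<integral>x. (q x)\<^sup>2 * \<bar>R x ?w\<bar> + (q x)\<^sup>2 * \<bar>R x ?z\<bar> \<partial>\<nu>)"
      unfolding distrib_left[symmetric] using H_le
      by (intro integral_mono nu.integrable_bounded_mble bounded_intros q Hb mult_left_mono) auto
    also have "\<dots> = \<psi> ?w + \<psi> ?z"
      unfolding \<psi>_def by (intro Bochner_Integration.integral_add nu.integrable_bounded_mble bounded_intros q)
    finally have 1: "(\<integral>x. (q x)\<^sup>2 * H x \<partial>\<nu>) \<le> \<psi> ?w + \<psi> ?z" .
    have "(\<integral>x. H x \<partial>\<nu>) \<le> (\<integral>x. \<bar>R x ?w\<bar> + \<bar>R x ?z\<bar> \<partial>\<nu>)"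
      using H_le by (intro integral_mono nu.integrable_bounded_mble bounded_intros Hb) auto
    also have "\<dots> = (\<integral>x. \<bar>R x ?w\<bar> \<partial>\<nu>) + (\<integral>x. \<bar>R x ?z\<bar> \<partial>\<nu>)"
      by (intro Bochner_Integration.integral_add nu.integrable_bounded_mble bounded_intros)
    finally have 2: "(\<integral>x. H x \<partial>\<nu>) \<le> 2 * \<kappa>" using R_int[of ?w] R_int[of ?z] by simp
    have "T p \<le> L * (\<kappa> * q2 + (\<integral>x. (q x)\<^sup>2 * H x \<partial>\<nu>) / 2 + q2 * (\<integral>x. H x \<partial>\<nu>) / 2)"
      using tilted_second_moment(2)[OF q, of ?w ?z] by (simp add: T_def H_def q2_def)
    also have "\<dots> \<le> L * (\<kappa> * q2 + (\<psi> ?w + \<psi> ?z) / 2 + q2 * (2 * \<kappa>) / 2)"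
      using L_nonneg \<kappa>_nonneg 1 2 nn by (intro mult_left_mono add_mono divide_right_mono) auto
    also have "\<dots> = L * (2 * \<kappa> * q2 + (\<psi> ?w + \<psi> ?z) / 2)" by simp
    finally show ?thesis .
  qed
  have T_nn: "T p \<ge> 0" for p
    unfolding T_def
    by (intro integral_nonneg_AE AE_I2 mult_nonneg_nonneg divide_nonneg_nonneg less_imp_le[OF b_pos] zero_le_power2)
  obtain B where B: "B \<ge> 0" "\<And>x. \<bar>(g x)\<^sup>2\<bar> \<le> B" 
    using bounded_mble_bound[OF bounded_mble_power[OF g, of 2]] by blast
  define F where "F = (\<lambda>(p, \<omega>). (g (fst p))\<^sup>2 * ((fluct q \<omega>)\<^sup>2 * (b (fst p) \<omega> / b (snd p) \<omega>)))"
  have Fm: "F \<in> borel_measurable ((\<nu> \<Otimes>\<^sub>M \<nu>) \<Otimes>\<^sub>M P)"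
    unfolding F_def by measurable
  have Fi: "integrable P (\<lambda>\<omega>. F (p, \<omega>))" for p
    unfolding F_def prod.case by (intro integrable_mult_right tilted_second_moment(1) q)
  have FT: "(\<integral>\<omega>. F (p, \<omega>) \<partial>P) = (g (fst p))\<^sup>2 * T p" for p
    unfolding F_def T_def prod.case by (rule integral_mult_right_zero)
  have F_nn: "F (p, \<omega>) \<ge> 0" for p \<omega>
    unfolding F_def prod.case
    by (intro mult_nonneg_nonneg divide_nonneg_nonneg less_imp_le[OF b_pos] zero_le_power2)
  have Fb: "(\<integral>\<omega>. \<bar>F (p, \<omega>)\<bar> \<partial>P) \<le> B * (L * (2 * \<kappa> * q2 + (K * q2 + K * q2) / 2))" for p
  proof -
    have "(\<integral>\<omega>. \<bar>F (p, \<omega>)\<bar> \<partial>P) = (g (fst p))\<^sup>2 * T p"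
      using F_nn FT by simp
    also have "\<dots> \<le> B * (L * (2 * \<kappa> * q2 + (\<psi> (fst p) + \<psi> (snd p)) / 2))"
      using B(2)[of "fst p"] B(1) T_le T_nn by (intro mult_mono) auto
    also have "\<dots> \<le> B * (L * (2 * \<kappa> * q2 + (K * q2 + K * q2) / 2))"
      using B(1) L_nonneg \<kappa>_nonneg \<psi>_le by (intro mult_left_mono add_mono divide_right_mono) auto
    finally show ?thesis .
  qed
  have WF: "(\<integral>p. F (p, \<omega>) \<partial>(\<nu> \<Otimes>\<^sub>M \<nu>)) = W \<omega>" if "\<omega> \<in> space P" for \<omega>
  proof -
    have "(\<integral>p. F (p, \<omega>) \<partial>(\<nu> \<Otimes>\<^sub>M \<nu>))
        = (\<integral>p. (fluct q \<omega>)\<^sup>2 * ((b (fst p) \<omega> * (g (fst p))\<^sup>2) * (1 / b (snd p) \<omega>)) \<partial>(\<nu> \<Otimes>\<^sub>M \<nu>))"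
      by (simp add: F_def mult_ac)
    also have "\<dots> = (fluct q \<omega>)\<^sup>2 * (\<integral>p. (b (fst p) \<omega> * (g (fst p))\<^sup>2) * (1 / b (snd p) \<omega>) \<partial>(\<nu> \<Otimes>\<^sub>M \<nu>))"
      by (rule integral_mult_right_zero)
    also have "\<dots> = W \<omega>"
      unfolding W_def
      by (subst integral_product_pair[where f = "\<lambda>x. b x \<omega> * (g x)\<^sup>2" and g = "\<lambda>x. 1 / b x \<omega>"])
        (auto intro!: bounded_intros bounded_b g that)
    finally show ?thesis .
  qed
  note Fub = Fubini_uniform_bound[OF nu2.finite_measure_axioms Fm Fi Fb]
  show "integrable P W"
    using Fub(1) WF by (simp cong: Bochner_Integration.integrable_cong)
  have "(\<integral>\<omega>. W \<omega> \<partial>P) = (\<integral>p. (\<integral>\<omega>. F (p, \<omega>) \<partial>P) \<partial>(\<nu> \<Otimes>\<^sub>M \<nu>))"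
    using Fub(2) WF by (simp cong: Bochner_Integration.integral_cong)
  also have "\<dots> \<le> (\<integral>p. L * ((2 * \<kappa> * q2) * ((g (fst p))\<^sup>2 * 1) + (1 / 2) * ((g (fst p))\<^sup>2 * \<psi> (fst p) * 1)
        + (1 / 2) * ((g (fst p))\<^sup>2 * \<psi> (snd p))) \<partial>(\<nu> \<Otimes>\<^sub>M \<nu>))"
  proof (rule integral_mono[OF Fub(3)])
    show "integrable (\<nu> \<Otimes>\<^sub>M \<nu>) (\<lambda>p. L * ((2 * \<kappa> * q2) * ((g (fst p))\<^sup>2 * 1) + (1 / 2) * ((g (fst p))\<^sup>2 * \<psi> (fst p) * 1)
        + (1 / 2) * ((g (fst p))\<^sup>2 * \<psi> (snd p))))"
      by (intro nu2.integrable_bounded_mble bounded_intros g \<psi>_b)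
    fix p
    have "(\<integral>\<omega>. F (p, \<omega>) \<partial>P) \<le> (g (fst p))\<^sup>2 * (L * (2 * \<kappa> * q2 + (\<psi> (fst p) + \<psi> (snd p)) / 2))"
      unfolding FT by (intro mult_left_mono T_le) simp
    then show "(\<integral>\<omega>. F (p, \<omega>) \<partial>P) \<le> L * ((2 * \<kappa> * q2) * ((g (fst p))\<^sup>2 * 1)
        + (1 / 2) * ((g (fst p))\<^sup>2 * \<psi> (fst p) * 1) + (1 / 2) * ((g (fst p))\<^sup>2 * \<psi> (snd p)))"
      by (simp add: algebra_simps add_divide_distrib)
  qed
  also have "\<dots> = L * ((2 * \<kappa> * q2) * (\<integral>p. (g (fst p))\<^sup>2 * 1 \<partial>(\<nu> \<Otimes>\<^sub>M \<nu>))
        + (1 / 2) * (\<integral>p. (g (fst p))\<^sup>2 * \<psi> (fst p) * 1 \<partial>(\<nu> \<Otimes>\<^sub>M \<nu>))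
        + (1 / 2) * (\<integral>p. (g (fst p))\<^sup>2 * \<psi> (snd p) \<partial>(\<nu> \<Otimes>\<^sub>M \<nu>)))"
  proof -
    have i: "integrable (\<nu> \<Otimes>\<^sub>M \<nu>) (\<lambda>p. (g (fst p))\<^sup>2 * 1)"
      "integrable (\<nu> \<Otimes>\<^sub>M \<nu>) (\<lambda>p. (g (fst p))\<^sup>2 * \<psi> (fst p) * 1)"
      "integrable (\<nu> \<Otimes>\<^sub>M \<nu>) (\<lambda>p. (g (fst p))\<^sup>2 * \<psi> (snd p))"
      by (intro nu2.integrable_bounded_mble bounded_intros g \<psi>_b)+
    show ?thesis using i
      by (simp only: integral_mult_right_zero integrable_mult_right Bochner_Integration.integral_add
          Bochner_Integration.integrable_add)
  qed
  also have "(\<integral>p. (g (fst p))\<^sup>2 * 1 \<partial>(\<nu> \<Otimes>\<^sub>M \<nu>)) = g2"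
    by (subst integral_product_pair[where f = "\<lambda>x. (g x)\<^sup>2" and g = "\<lambda>_. 1"])
      (auto intro!: bounded_intros g simp: nu.prob_space g2_def)
  also have "(\<integral>p. (g (fst p))\<^sup>2 * \<psi> (fst p) * 1 \<partial>(\<nu> \<Otimes>\<^sub>M \<nu>)) = (\<integral>w. (g w)\<^sup>2 * \<psi> w \<partial>\<nu>)"
    by (subst integral_product_pair[where f = "\<lambda>x. (g x)\<^sup>2 * \<psi> x" and g = "\<lambda>_. 1"])
      (auto intro!: bounded_intros g \<psi>_b simp: nu.prob_space)
  also have "(\<integral>p. (g (fst p))\<^sup>2 * \<psi> (snd p) \<partial>(\<nu> \<Otimes>\<^sub>M \<nu>)) = g2 * (\<integral>w. \<psi> w \<partial>\<nu>)"
    by (subst integral_product_pair[where f = "\<lambda>x. (g x)\<^sup>2" and g = \<psi>])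
      (auto intro!: bounded_intros g \<psi>_b simp: g2_def)
  also have "(\<integral>w. (g w)\<^sup>2 * \<psi> w \<partial>\<nu>) \<le> \<kappa> * sqrt (q4 * g4)"
  proof -
    have "(\<integral>w. (g w)\<^sup>2 * \<psi> w \<partial>\<nu>) = (\<integral>p. \<bar>(q (fst p))\<^sup>2\<bar> * \<bar>(g (snd p))\<^sup>2\<bar> * \<bar>R (fst p) (snd p)\<bar> \<partial>(\<nu> \<Otimes>\<^sub>M \<nu>))"
      by (subst double_integral(2)) (auto intro!: bounded_intros q g simp: \<psi>_def mult_ac simp flip: integral_mult_right_zero)
    also have "\<dots> \<le> \<kappa> * sqrt (q4 * g4)"
      using Schur_test[of "\<lambda>x. (q x)\<^sup>2" "\<lambda>x. (g x)\<^sup>2"] q g by (auto simp: q4_def g4_def intro!: bounded_intros)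
    finally show ?thesis .
  qed
  also have "(\<integral>w. \<psi> w \<partial>\<nu>) \<le> \<kappa> * q2"
  proof -
    have "(\<integral>w. \<psi> w \<partial>\<nu>) = (\<integral>p. (q (fst p))\<^sup>2 * \<bar>R (fst p) (snd p)\<bar> \<partial>(\<nu> \<Otimes>\<^sub>M \<nu>))"
      by (subst double_integral(2)) (auto intro!: bounded_intros q simp: \<psi>_def[abs_def])
    also have "\<dots> \<le> \<kappa> * q2"
      using kernel_row_bound(1)[of "\<lambda>x. (q x)\<^sup>2"] q by (auto simp: q2_def intro!: bounded_intros)
    finally show ?thesis .
  qed
  also have "L * (2 * \<kappa> * q2 * g2 + 1 / 2 * (\<kappa> * sqrt (q4 * g4)) + 1 / 2 * (g2 * (\<kappa> * q2)))
      = L * \<kappa> * (5 / 2 * (q2 * g2) + 1 / 2 * sqrt (q4 * g4))"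
    by (simp add: algebra_simps)
  also have "\<dots> \<le> L * \<kappa> * (5 / 2 * sqrt (q4 * g4) + 1 / 2 * sqrt (q4 * g4))"
    using L_nonneg \<kappa>_nonneg L2_le_L4 by (intro mult_left_mono add_mono) auto
  finally show "(\<integral>\<omega>. W \<omega> \<partial>P) \<le> 3 * L * \<kappa> * sqrt ((\<integral>x. (q x) ^ 4 \<partial>\<nu>) * (\<integral>x. (g x) ^ 4 \<partial>\<nu>))"
    using L_nonneg \<kappa>_nonneg nn by (simp add: q4_def g4_def mult_left_mono)
qed

text \<open>The total mass of \<open>b\<close> times the covariance of \<open>f\<close> and \<open>g\<close> under the normalised measure.\<close>

definition weighted_cov :: "('x \<Rightarrow> real) \<Rightarrow> ('x \<Rightarrow> real) \<Rightarrow> 'w \<Rightarrow> real" where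
  "weighted_cov f g \<omega> = (\<integral>x. b x \<omega> * (f x * g x) \<partial>\<nu>)
     - (\<integral>x. b x \<omega> * f x \<partial>\<nu>) * (\<integral>x. b x \<omega> * g x \<partial>\<nu>) / (\<integral>x. b x \<omega> \<partial>\<nu>)"

lemma mass_pos: "\<omega> \<in> space P \<Longrightarrow> (\<integral>x. b x \<omega> \<partial>\<nu>) > 0"
  using b_pos by (intro nu.expectation_greater nu.integrable_bounded_mble bounded_b(1)) auto

lemma weighted_cov_measurable:
  assumes "bounded_mble \<nu> f" "bounded_mble \<nu> g"
  shows "weighted_cov f g \<in> borel_measurable P"
proof -
  have [measurable]: "f \<in> borel_measurable \<nu>" "g \<in> borel_measurable \<nu>" 
    using assms by (auto intro: bounded_mble_measurable)
  show ?thesis unfolding weighted_cov_def by measurable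
qed

lemma weighted_cov_shift:
  assumes f: "bounded_mble \<nu> f" and g: "bounded_mble \<nu> g" and \<omega>: "\<omega> \<in> space P"
  shows "weighted_cov (\<lambda>x. f x - c) (\<lambda>x. g x - d) \<omega> = weighted_cov f g \<omega>"
proof -
  note bb = bounded_b(1)[OF \<omega>]
  have i: "integrable \<nu> (\<lambda>x. b x \<omega> * (f x * g x))" "integrable \<nu> (\<lambda>x. b x \<omega> * f x)"
    "integrable \<nu> (\<lambda>x. b x \<omega> * g x)" "integrable \<nu> (\<lambda>x. b x \<omega>)"
    by (intro nu.integrable_bounded_mble bounded_intros f g bb)+
  define S F1 G1 where "S = (\<integral>x. b x \<omega> \<partial>\<nu>)" "F1 = (\<integral>x. b x \<omega> * f x \<partial>\<nu>)" "G1 = (\<integral>x. b x \<omega> * g x \<partial>\<nu>)"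
  have "(\<integral>x. b x \<omega> * ((f x - c) * (g x - d)) \<partial>\<nu>)
      = (\<integral>x. b x \<omega> * (f x * g x) - d * (b x \<omega> * f x) - c * (b x \<omega> * g x) + c * d * b x \<omega> \<partial>\<nu>)"
    by (simp add: algebra_simps)
  also have "\<dots> = (\<integral>x. b x \<omega> * (f x * g x) \<partial>\<nu>) - d * F1 - c * G1 + c * d * S"
    using i by (simp add: S_F1_G1_def)
  finally have 1: "(\<integral>x. b x \<omega> * ((f x - c) * (g x - d)) \<partial>\<nu>) = (\<integral>x. b x \<omega> * (f x * g x) \<partial>\<nu>) - d * F1 - c * G1 + c * d * S" .
  have 2: "(\<integral>x. b x \<omega> * (f x - c) \<partial>\<nu>) = F1 - c * S" "(\<integral>x. b x \<omega> * (g x - d) \<partial>\<nu>) = G1 - d * S"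
    using i by (simp_all add: S_F1_G1_def right_diff_distrib mult.commute[of _ c] mult.commute[of _ d])
  have "S > 0" using mass_pos[OF \<omega>] by (simp add: S_F1_G1_def)
  then show ?thesis
    unfolding weighted_cov_def 1 2 S_F1_G1_def[symmetric] by (simp add: field_simps)
qed

text \<open>Dividing by the random mass is harmless: with \<open>S = \<integral> b\<close>, one Cauchy-Schwarz inequality trades
  \<open>(\<integral> b g)\<^sup>2 / S\<^sup>2\<close> for \<open>(\<integral> b g\<^sup>2) / S\<close>, and another one bounds \<open>1 / S\<close> by \<open>\<integral> 1/b\<close>.\<close>

lemma weighted_cov_centered_le:
  assumes f: "bounded_mble \<nu> f" and g: "bounded_mble \<nu> g" and \<omega>: "\<omega> \<in> space P"
    and mean_f: "(\<integral>x. f x \<partial>\<nu>) = 0"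
  shows "(weighted_cov f g \<omega> - m * (\<integral>x. f x * g x \<partial>\<nu>))\<^sup>2
     \<le> 2 * (fluct (\<lambda>x. f x * g x) \<omega>)\<^sup>2
       + 2 * ((fluct f \<omega>)\<^sup>2 * ((\<integral>x. b x \<omega> * (g x)\<^sup>2 \<partial>\<nu>) * (\<integral>x. 1 / b x \<omega> \<partial>\<nu>)))"
proof -
  note bb = bounded_b[OF \<omega>]
  have fl: "fluct q \<omega> = (\<integral>x. b x \<omega> * q x \<partial>\<nu>) - m * (\<integral>x. q x \<partial>\<nu>)" if "bounded_mble \<nu> q" for q
  proof -
    have "integrable \<nu> (\<lambda>x. b x \<omega> * q x)" "integrable \<nu> q"
      by (intro nu.integrable_bounded_mble bounded_intros that bb)+
    then show ?thesis by (simp add: fluct_def left_diff_distrib)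
  qed
  define S T A B V where "S = (\<integral>x. b x \<omega> \<partial>\<nu>)" "T = (\<integral>x. 1 / b x \<omega> \<partial>\<nu>)" "A = fluct f \<omega>"
    "B = (\<integral>x. b x \<omega> * g x \<partial>\<nu>)" "V = (\<integral>x. b x \<omega> * (g x)\<^sup>2 \<partial>\<nu>)"
  have S: "S > 0" using mass_pos[OF \<omega>] by (simp add: S_T_A_B_V_def)
  have sb: "bounded_mble \<nu> (\<lambda>x. sqrt \<bar>b x \<omega>\<bar>)" "bounded_mble \<nu> (\<lambda>x. sqrt \<bar>1 / b x \<omega>\<bar>)"
    by (intro bounded_intros bb)+
  have sq: "sqrt \<bar>b x \<omega>\<bar> * sqrt \<bar>1 / b x \<omega>\<bar> = 1" "(sqrt \<bar>b x \<omega>\<bar>)\<^sup>2 = b x \<omega>" "(sqrt \<bar>1 / b x \<omega>\<bar>)\<^sup>2 = 1 / b x \<omega>"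
      "sqrt \<bar>b x \<omega>\<bar> * (sqrt \<bar>b x \<omega>\<bar> * g x) = b x \<omega> * g x" for x
    using b_pos[of x \<omega>] by (auto simp flip: real_sqrt_mult mult.assoc)
  have ST: "1 \<le> S * T"
    using nu.Cauchy_Schwarz_bounded[OF sb] unfolding sq by (simp add: nu.prob_space S_T_A_B_V_def)
  have BV: "B\<^sup>2 \<le> S * V"
    using nu.Cauchy_Schwarz_bounded[OF sb(1) bounded_mble_mult[OF sb(1) g]]
    unfolding sq power_mult_distrib by (simp add: S_T_A_B_V_def)
  have V: "V \<ge> 0" 
    unfolding S_T_A_B_V_def
    by (intro integral_nonneg_AE AE_I2 mult_nonneg_nonneg less_imp_le[OF b_pos] zero_le_power2)
  have "B\<^sup>2 / S\<^sup>2 \<le> V / S" using BV S by (simp add: field_simps power2_eq_square)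
  also have "V / S \<le> V * T"
  proof -
    have "1 / S \<le> T" using ST S by (simp add: field_simps)
    from mult_left_mono[OF this V] show ?thesis by simp
  qed
  finally have BS: "B\<^sup>2 / S\<^sup>2 \<le> V * T" .
  have "weighted_cov f g \<omega> - m * (\<integral>x. f x * g x \<partial>\<nu>) = fluct (\<lambda>x. f x * g x) \<omega> - A * B / S"
    using fl[OF f] fl[OF bounded_mble_mult[OF f g]] mean_f by (simp add: weighted_cov_def S_T_A_B_V_def)
  also have "\<dots>\<^sup>2 \<le> 2 * (fluct (\<lambda>x. f x * g x) \<omega>)\<^sup>2 + 2 * (A * B / S)\<^sup>2"
    using sum_squares_bound[of "fluct (\<lambda>x. f x * g x) \<omega>" "- (A * B / S)"] by (simp add: power2_diff)
  also have "(A * B / S)\<^sup>2 = A\<^sup>2 * (B\<^sup>2 / S\<^sup>2)" by (simp add: power_mult_distrib power_divide)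
  also have "\<dots> \<le> A\<^sup>2 * (V * T)" by (intro mult_left_mono BS) simp
  finally show ?thesis by (simp add: S_T_A_B_V_def)
qed

text \<open>The variance is at most the mean square distance to any constant; the constant chosen is the mean of the
  leading term \<open>\<integral> b f g\<close> for the centred functions. Centring multiplies fourth moments by at
  most 16, and \<open>128 = 16 (2 + 2 \<cdot> 3)\<close>.\<close>

theorem weighted_cov_variance:
  assumes f: "bounded_mble \<nu> f" and g: "bounded_mble \<nu> g"
  shows "integrable P (\<lambda>\<omega>. (weighted_cov f g \<omega>)\<^sup>2)"
    and "variance (weighted_cov f g) \<le> 128 * L * \<kappa> * sqrt ((\<integral>x. (f x) ^ 4 \<partial>\<nu>) * (\<integral>x. (g x) ^ 4 \<partial>\<nu>))"
proof -
  define f0 g0 where "f0 = (\<lambda>x. f x - (\<integral>y. f y \<partial>\<nu>))" and "g0 = (\<lambda>x. g x - (\<integral>y. g y \<partial>\<nu>))"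
  have b0: "bounded_mble \<nu> f0" "bounded_mble \<nu> g0"
    unfolding f0_def g0_def by (intro bounded_intros f g)+
  have mean: "(\<integral>x. f0 x \<partial>\<nu>) = 0"
    using nu.integrable_bounded_mble[OF f] by (simp add: f0_def nu.prob_space)
  define r where "r = sqrt ((\<integral>x. (f x) ^ 4 \<partial>\<nu>) * (\<integral>x. (g x) ^ 4 \<partial>\<nu>))"
  have r0: "sqrt ((\<integral>x. (f0 x) ^ 4 \<partial>\<nu>) * (\<integral>x. (g0 x) ^ 4 \<partial>\<nu>)) \<le> 16 * r"
  proof -
    have "(\<integral>x. (f0 x) ^ 4 \<partial>\<nu>) * (\<integral>x. (g0 x) ^ 4 \<partial>\<nu>)
        \<le> (16 * (\<integral>x. (f x) ^ 4 \<partial>\<nu>)) * (16 * (\<integral>x. (g x) ^ 4 \<partial>\<nu>))"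
      unfolding f0_def g0_def by (intro mult_mono nu.fourth_moment_centered_le f g) auto
    also have "\<dots> = 16\<^sup>2 * ((\<integral>x. (f x) ^ 4 \<partial>\<nu>) * (\<integral>x. (g x) ^ 4 \<partial>\<nu>))" by simp
    finally have "sqrt ((\<integral>x. (f0 x) ^ 4 \<partial>\<nu>) * (\<integral>x. (g0 x) ^ 4 \<partial>\<nu>))
        \<le> sqrt (16\<^sup>2 * ((\<integral>x. (f x) ^ 4 \<partial>\<nu>) * (\<integral>x. (g x) ^ 4 \<partial>\<nu>)))"
      by (rule real_sqrt_le_mono)
    then show ?thesis by (simp only: real_sqrt_mult[of "16\<^sup>2"] r_def) simp
  qed
  define q where "q = (\<lambda>x. f0 x * g0 x)"
  have qb: "bounded_mble \<nu> q" unfolding q_def by (intro bounded_intros b0)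
  have q2: "(\<integral>x. (q x)\<^sup>2 \<partial>\<nu>) \<le> 16 * r"
  proof -
    have "(\<integral>x. (f0 x)\<^sup>2 * (g0 x)\<^sup>2 \<partial>\<nu>)\<^sup>2 \<le> (\<integral>x. ((f0 x)\<^sup>2)\<^sup>2 \<partial>\<nu>) * (\<integral>x. ((g0 x)\<^sup>2)\<^sup>2 \<partial>\<nu>)"
      by (intro nu.Cauchy_Schwarz_bounded bounded_intros b0)
    then have "(\<integral>x. (q x)\<^sup>2 \<partial>\<nu>) \<le> sqrt ((\<integral>x. (f0 x) ^ 4 \<partial>\<nu>) * (\<integral>x. (g0 x) ^ 4 \<partial>\<nu>))"
      by (intro real_le_rsqrt) (simp add: q_def power_mult_distrib)
    with r0 show ?thesis by linarith
  qed
  define c where "c = m * (\<integral>x. q x \<partial>\<nu>)"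
  define J where "J = weighted_cov f g"
  define W where "W \<omega> = (fluct f0 \<omega>)\<^sup>2 * ((\<integral>x. b x \<omega> * (g0 x)\<^sup>2 \<partial>\<nu>) * (\<integral>x. 1 / b x \<omega> \<partial>\<nu>))" for \<omega>
  have [measurable]: "J \<in> borel_measurable P" unfolding J_def by (intro weighted_cov_measurable f g)
  have le: "(J \<omega> - c)\<^sup>2 \<le> 2 * (fluct q \<omega>)\<^sup>2 + 2 * W \<omega>" if "\<omega> \<in> space P" for \<omega>
    using weighted_cov_centered_le[OF b0 that mean] weighted_cov_shift[OF f g that]
    by (simp add: J_def c_def W_def q_def f0_def g0_def)
  have Wi: "integrable P W" 
    unfolding W_def by (intro weighted_product_bound b0)
  have EW: "(\<integral>\<omega>. W \<omega> \<partial>P) \<le> 3 * L * \<kappa> * (16 * r)"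
  proof -
    have "(\<integral>\<omega>. W \<omega> \<partial>P) \<le> 3 * L * \<kappa> * sqrt ((\<integral>x. (f0 x) ^ 4 \<partial>\<nu>) * (\<integral>x. (g0 x) ^ 4 \<partial>\<nu>))"
      unfolding W_def by (intro weighted_product_bound b0)
    also have "\<dots> \<le> 3 * L * \<kappa> * (16 * r)"
      using L_nonneg \<kappa>_nonneg by (intro mult_left_mono r0) auto
    finally show ?thesis .
  qed
  have Ri: "integrable P (\<lambda>\<omega>. 2 * (fluct q \<omega>)\<^sup>2 + 2 * W \<omega>)"
    using fluct_second_moment(1)[OF qb] Wi by simp
  have Jci: "integrable P (\<lambda>\<omega>. (J \<omega> - c)\<^sup>2)"
    by (rule Bochner_Integration.integrable_bound[OF Ri]) (use le in \<open>auto intro!: AE_I2 order_trans[OF _ abs_ge_self]\<close>)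
  have Ji: "integrable P (\<lambda>\<omega>. (J \<omega>)\<^sup>2)"
  proof (rule Bochner_Integration.integrable_bound)
    show "integrable P (\<lambda>\<omega>. 2 * (J \<omega> - c)\<^sup>2 + 2 * c\<^sup>2)" using Jci by simp
    have "(J \<omega>)\<^sup>2 \<le> 2 * (J \<omega> - c)\<^sup>2 + 2 * c\<^sup>2" for \<omega>
      using sum_squares_bound[of "J \<omega> - c" c] by (simp add: power2_eq_square algebra_simps)
    then show "AE \<omega> in P. norm ((J \<omega>)\<^sup>2) \<le> norm (2 * (J \<omega> - c)\<^sup>2 + 2 * c\<^sup>2)" by auto
  qed auto
  then show "integrable P (\<lambda>\<omega>. (weighted_cov f g \<omega>)\<^sup>2)" by (simp add: J_def)
  have J1: "integrable P J"
    using square_integrable_imp_integrable[of J] Ji by simp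
  have "variance J \<le> (\<integral>\<omega>. (J \<omega> - c)\<^sup>2 \<partial>P)"
  proof -
    have "(\<integral>\<omega>. (J \<omega> - c)\<^sup>2 \<partial>P) = (\<integral>\<omega>. (J \<omega>)\<^sup>2 - (2 * c) * J \<omega> + c\<^sup>2 \<partial>P)"
      by (simp add: power2_eq_square algebra_simps)
    also have "\<dots> = (\<integral>\<omega>. (J \<omega>)\<^sup>2 \<partial>P) - (2 * c) * (\<integral>\<omega>. J \<omega> \<partial>P) + c\<^sup>2"
      using Ji J1 by (simp add: prob_space)
    also have "\<dots> = variance J + ((\<integral>\<omega>. J \<omega> \<partial>P) - c)\<^sup>2"
      using variance_eq[OF J1 Ji] by (simp add: power2_diff)
    finally show ?thesis by simp
  qed
  also have "\<dots> \<le> (\<integral>\<omega>. 2 * (fluct q \<omega>)\<^sup>2 + 2 * W \<omega> \<partial>P)"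
    by (rule integral_mono[OF Jci Ri le])
  also have "\<dots> = 2 * (\<integral>\<omega>. (fluct q \<omega>)\<^sup>2 \<partial>P) + 2 * (\<integral>\<omega>. W \<omega> \<partial>P)"
    using fluct_second_moment(1)[OF qb] Wi by simp
  also have "\<dots> \<le> 2 * (L * \<kappa> * (16 * r)) + 2 * (3 * L * \<kappa> * (16 * r))"
  proof -
    have "L * \<kappa> * (\<integral>x. (q x)\<^sup>2 \<partial>\<nu>) \<le> L * \<kappa> * (16 * r)"
      using q2 L_nonneg \<kappa>_nonneg by (intro mult_left_mono) auto
    with fluct_second_moment(2)[OF qb] EW show ?thesis by linarith
  qed
  finally show "variance (weighted_cov f g) \<le> 128 * L * \<kappa> * sqrt ((\<integral>x. (f x) ^ 4 \<partial>\<nu>) * (\<integral>x. (g x) ^ 4 \<partial>\<nu>))"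
    by (simp add: J_def r_def mult_ac)
qed

end

section \<open>The uniform law on the unit interval\<close>

definition unit_uniform :: "real measure" where
  "unit_uniform = density lborel (\<lambda>x. ennreal (indicator {0..1} x))"

text \<open>All functions on \<open>[0,1]\<close> are precomposed with this retraction. They become continuous and bounded on the
  whole line without changing their integrals over \<open>[0,1]\<close>.\<close>

definition proj01 :: "real \<Rightarrow> real" where "proj01 x = max 0 (min 1 x)"

lemma proj01_in: "proj01 x \<in> {0..1}" by (simp add: proj01_def)

lemma proj01_id: "x \<in> {0..1} \<Longrightarrow> proj01 x = x" by (simp add: proj01_def)

lemma continuous_proj01: "continuous_on UNIV proj01"
  unfolding proj01_def by (intro continuous_intros)

lemma measurable_proj01 [measurable]: "proj01 \<in> borel_measurable borel"
  by (rule borel_measurable_continuous_onI[OF continuous_proj01])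

lemma sets_unit_uniform [simp, measurable_cong]: "sets unit_uniform = sets borel"
  by (simp add: unit_uniform_def)

lemma space_unit_uniform [simp]: "space unit_uniform = UNIV"
  by (simp add: unit_uniform_def)

lemma prob_space_unit_uniform: "prob_space unit_uniform"
proof
  have "emeasure unit_uniform UNIV = (\<integral>\<^sup>+x. indicator {0..1::real} x \<partial>lborel)"
    by (simp add: unit_uniform_def emeasure_density ennreal_indicator)
  then show "emeasure unit_uniform (space unit_uniform) = 1" by simp
qed

lemma integral_unit_uniform:
  fixes f :: "real \<Rightarrow> real"
  assumes "f \<in> borel_measurable borel"
  shows "(\<integral>x. f x \<partial>unit_uniform) = (LINT x:{0..1}|lborel. f x)"
  using assms by (simp add: unit_uniform_def integral_density set_lebesgue_integral_def)

lemma integral_unit_uniform_henstock: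
  fixes f :: "real \<Rightarrow> real"
  assumes "continuous_on UNIV f"
  shows "(\<integral>x. f x \<partial>unit_uniform) = integral {0..1} f"
proof -
  have "set_integrable lborel {0..1} f"
    using assms continuous_on_subset by (intro borel_integrable_atLeastAtMost') auto
  then show ?thesis
    using assms by (simp add: integral_unit_uniform borel_measurable_continuous_onI set_borel_integral_eq_integral)
qed

lemma continuous_proj01_compose:
  assumes "continuous_on {0..1} (f :: real \<Rightarrow> real)" shows "continuous_on UNIV (\<lambda>x. f (proj01 x))"
  using proj01_in by (intro continuous_on_compose2[OF assms continuous_proj01]) auto

lemma bounded_mble_proj01:
  assumes "continuous_on {0..1} f" shows "bounded_mble unit_uniform (\<lambda>x. f (proj01 x))"
proof -
  have "compact (f ` {0..1})" using assms by (intro compact_continuous_image) auto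
  then obtain B where "\<forall>y\<in>{0..1}. \<bar>f y\<bar> \<le> B"
    by (auto dest!: compact_imp_bounded simp: bounded_iff)
  then have "\<bar>f (proj01 x)\<bar> \<le> B" for x using proj01_in by blast
  moreover have "continuous_on UNIV (\<lambda>x. f (proj01 x))"
    using assms by (rule continuous_proj01_compose)
  then have "(\<lambda>x. f (proj01 x)) \<in> borel_measurable unit_uniform"
    using borel_measurable_continuous_onI measurable_cong_sets[OF sets_unit_uniform refl] by blast
  ultimately show ?thesis by (intro bounded_mbleI)
qed

section \<open>The one-dimensional Dirichlet problem\<close>

lemma C1_unit_interval_continuous:
  "C1_unit_interval h \<Longrightarrow> continuous_on {0..1} h"
  unfolding C1_unit_interval_def by (meson DERIV_continuous continuous_on_eq_continuous_within)

lemma C1_unit_interval_deriv: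
  assumes "C1_unit_interval h" "x \<in> {0<..<1}"
  shows "(h has_real_derivative deriv h x) (at x)"
proof -
  obtain h' where "(h has_real_derivative h') (at x within {0..1})"
    using assms unfolding C1_unit_interval_def by (meson greaterThanLessThan_subseteq_atLeastAtMost_iff order_refl subsetD)
  moreover have "at x within {0..1} = at x" using assms(2) by (intro at_within_Icc_at) auto
  ultimately show ?thesis using DERIV_imp_deriv by force
qed

lemma L4_norm_square:
  assumes "continuous_on {0..1} h"
  shows "(L4_norm h)\<^sup>2 = sqrt (\<integral>x. (h (proj01 x)) ^ 4 \<partial>unit_uniform)"
proof -
  have "(LINT x:{0..1}|lborel. \<bar>h x\<bar> ^ 4) = (LINT x:{0..1}|lborel. (h (proj01 x)) ^ 4)"
    by (rule set_lebesgue_integral_cong) (auto simp: proj01_id)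
  also have "\<dots> = (\<integral>x. (h (proj01 x)) ^ 4 \<partial>unit_uniform)"
    using bounded_mble_measurable[OF bounded_mble_proj01[OF assms]]
    by (intro integral_unit_uniform[symmetric]) (simp add: unit_uniform_def)
  finally have e: "L4_norm h = (\<integral>x. (h (proj01 x)) ^ 4 \<partial>unit_uniform) powr (1 / 4)"
    by (simp add: L4_norm_def)
  then show ?thesis
    by (simp add: power2_eq_square powr_half_sqrt flip: powr_add)
qed

text \<open>The flux \<open>A u'\<close> differs from \<open>f\<close> by a constant \<open>c\<close>, hence \<open>u' = (f + c) / A\<close>; since \<open>u\<close> vanishes at both ends,
  the integral of \<open>u'\<close> is zero, which determines \<open>c\<close>.\<close>

lemma dirichlet_I_functional:
  fixes A :: "real \<Rightarrow> real"
  assumes A: "continuous_on UNIV A" "\<And>x. A x > 0"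
    and f: "C1_unit_interval f" and g: "C1_unit_interval g" and u: "dirichlet_solution A f u"
  defines "B \<equiv> \<lambda>x. 1 / A (proj01 x)" and "F \<equiv> \<lambda>x. f (proj01 x)" and "H \<equiv> \<lambda>x. g (proj01 x)"
  shows "I_functional u g = (\<integral>x. B x * (F x * H x) \<partial>unit_uniform)
     - (\<integral>x. B x * F x \<partial>unit_uniform) * (\<integral>x. B x * H x \<partial>unit_uniform) / (\<integral>x. B x \<partial>unit_uniform)"
proof -
  interpret U: prob_space unit_uniform by (rule prob_space_unit_uniform)
  have uC1: "C1_unit_interval u" and u0: "u 0 = 0" "u 1 = 0"
    and eq: "\<And>x. x \<in> {0<..<1} \<Longrightarrow> ((\<lambda>y. A y * deriv u y) has_real_derivative deriv f x) (at x)"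
    using u by (auto simp: dirichlet_solution_def)
  have "((\<lambda>y. A y * deriv u y - f y) has_real_derivative 0) (at x within {0<..<1})" if "x \<in> {0<..<1}" for x
    using DERIV_diff[OF eq[OF that] C1_unit_interval_deriv[OF f that]] 
    by (auto intro: has_field_derivative_at_within)
  then have "\<exists>c. \<forall>x\<in>{0<..<1}. A x * deriv u x - f x = c"
    by (intro has_field_derivative_zero_constant) auto
  then obtain c where "\<And>x. x \<in> {0<..<1} \<Longrightarrow> A x * deriv u x - f x = c" by blast
  then have du: "deriv u x = B x * (F x + c)" if "x \<in> {0<..<1}" for x
    using that A(2)[of x] proj01_id[of x] by (fastforce simp: B_def F_def field_simps)
  have "continuous_on {0..1} (\<lambda>x. 1 / A x)"
    using A(2) by (intro continuous_intros continuous_on_subset[OF A(1)]) (auto simp: less_imp_neq[THEN not_sym])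
  then have cB: "continuous_on UNIV B" and bB: "bounded_mble unit_uniform B"
    unfolding B_def by (rule continuous_proj01_compose bounded_mble_proj01)+
  have cF: "continuous_on UNIV F" and bF: "bounded_mble unit_uniform F"
    unfolding F_def using C1_unit_interval_continuous[OF f] by (rule continuous_proj01_compose bounded_mble_proj01)+
  have cH: "continuous_on UNIV H" and bH: "bounded_mble unit_uniform H"
    unfolding H_def using C1_unit_interval_continuous[OF g] by (rule continuous_proj01_compose bounded_mble_proj01)+
  have [measurable]: "B \<in> borel_measurable borel" "F \<in> borel_measurable borel" "H \<in> borel_measurable borel"
    using cB cF cH by (auto intro: borel_measurable_continuous_onI)
  have i: "integrable unit_uniform (\<lambda>x. B x * (F x * H x))" "integrable unit_uniform (\<lambda>x. B x * F x)"
    "integrable unit_uniform (\<lambda>x. B x * H x)" "integrable unit_uniform B"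
    by (intro U.integrable_bounded_mble bounded_mble_intros bB bF bH)+
  have "(\<integral>x. B x * (F x + c) \<partial>unit_uniform) = integral {0..1} (\<lambda>x. B x * (F x + c))"
    by (intro integral_unit_uniform_henstock continuous_intros cB cF)
  also have "\<dots> = u 1 - u 0"
  proof (rule integral_unique, rule fundamental_theorem_of_calculus_interior)
    show "continuous_on {0..1} u" using uC1 by (rule C1_unit_interval_continuous)
    show "(u has_vector_derivative B x * (F x + c)) (at x)" if "x \<in> {0<..<1}" for x
      using C1_unit_interval_deriv[OF uC1 that] du[OF that] by (simp add: has_real_derivative_iff_has_vector_derivative)
  qed simp
  also have "\<dots> = 0" using u0 by simp
  finally have flux: "(\<integral>x. B x * F x \<partial>unit_uniform) + (\<integral>x. B x \<partial>unit_uniform) * c = 0"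
    using i by (simp add: distrib_left)
  have S: "(\<integral>x. B x \<partial>unit_uniform) > 0"
    using i A(2) by (intro U.expectation_greater) (auto simp: B_def)
  have "I_functional u g = (\<integral>x. indicator {0..1} x * (deriv u x * g x) \<partial>lborel)"
    by (simp add: I_functional_def set_lebesgue_integral_def)
  also have "\<dots> = (\<integral>x. indicator {0..1} x * (B x * (F x + c) * H x) \<partial>lborel)"
  proof (rule integral_cong_AE)
    \<comment> \<open>Isolating the end points, where \<open>deriv u\<close> is arbitrary, shows that the integrand is measurable.\<close>
    have "(\<lambda>x. indicator {0..1} x * (deriv u x * g x))
      = (\<lambda>x. indicator {0<..<1} x * (B x * (F x + c) * H x) + (deriv u 0 * g 0) * indicator {0} x
            + (deriv u 1 * g 1) * indicator {1::real} x)"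
      by (auto simp: fun_eq_iff du H_def proj01_id split: split_indicator)
    then show "(\<lambda>x. indicator {0..1} x * (deriv u x * g x)) \<in> borel_measurable lborel" by simp
    have "AE x in lborel. x \<noteq> (0::real) \<and> x \<noteq> 1" 
      using AE_lborel_singleton[of "0::real"] AE_lborel_singleton[of "1::real"] by eventually_elim auto
    then show "AE x in lborel. indicator {0..1} x * (deriv u x * g x) = indicator {0..1} x * (B x * (F x + c) * H x)"
      by eventually_elim (auto simp: du H_def proj01_id split: split_indicator)
  qed simp
  also have "\<dots> = (\<integral>x. B x * (F x + c) * H x \<partial>unit_uniform)"
    by (subst integral_unit_uniform) (simp_all add: set_lebesgue_integral_def)
  also have "\<dots> = (\<integral>x. B x * (F x * H x) + c * (B x * H x) \<partial>unit_uniform)"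
    by (simp add: algebra_simps)
  also have "\<dots> = (\<integral>x. B x * (F x * H x) \<partial>unit_uniform) + c * (\<integral>x. B x * H x \<partial>unit_uniform)"
    using i by simp
  also have "c = - (\<integral>x. B x * F x \<partial>unit_uniform) / (\<integral>x. B x \<partial>unit_uniform)"
    using flux S by (simp add: field_simps)
  finally show ?thesis by simp
qed

section \<open>Measurability on path space\<close>

text \<open>Rounding the position down to a multiple of \<open>1 / (n + 1)\<close> leaves countably many random variables, and
  continuity of the paths recovers the field in the limit.\<close>

lemma measurable_continuous_field:
  fixes G :: "real \<Rightarrow> 'w \<Rightarrow> real"
  assumes G: "\<And>x. G x \<in> borel_measurable P"
    and cont: "\<And>\<omega>. \<omega> \<in> space P \<Longrightarrow> continuous_on UNIV (\<lambda>x. G x \<omega>)"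
  shows "(\<lambda>(x, \<omega>). G x \<omega>) \<in> borel_measurable (borel \<Otimes>\<^sub>M P)"
proof (rule borel_measurable_LIMSEQ_real)
  fix n :: nat
  show "(\<lambda>p. G (real_of_int \<lfloor>fst p * real (Suc n)\<rfloor> / real (Suc n)) (snd p)) \<in> borel_measurable (borel \<Otimes>\<^sub>M P)"
  proof (rule measurable_compose_countable[where f = "\<lambda>k p. G (real_of_int k / real (Suc n)) (snd p)"])
    show "(\<lambda>p. G (real_of_int k / real (Suc n)) (snd p)) \<in> borel_measurable (borel \<Otimes>\<^sub>M P)" for k :: int
      using G by measurable
  qed measurable
next
  fix p :: "real \<times> 'w" assume "p \<in> space (borel \<Otimes>\<^sub>M P)"
  then have \<omega>: "snd p \<in> space P" by (auto simp: space_pair_measure)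
  have "(\<lambda>n. real_of_int \<lfloor>fst p * real (Suc n)\<rfloor> / real (Suc n)) \<longlonglongrightarrow> fst p"
  proof (rule tendsto_sandwich)
    have "(\<lambda>n. fst p - 1 / real (Suc n)) \<longlonglongrightarrow> fst p - 0"
      by (intro tendsto_diff tendsto_const LIMSEQ_Suc lim_1_over_n)
    then show "(\<lambda>n. fst p - 1 / real (Suc n)) \<longlonglongrightarrow> fst p" by simp
    show "\<forall>\<^sub>F n in sequentially. fst p - 1 / real (Suc n) \<le> real_of_int \<lfloor>fst p * real (Suc n)\<rfloor> / real (Suc n)"
    proof (rule always_eventually, rule allI)
      fix n
      have "fst p * real (Suc n) - 1 \<le> real_of_int \<lfloor>fst p * real (Suc n)\<rfloor>" by linarith
      then have "(fst p * real (Suc n) - 1) / real (Suc n) \<le> real_of_int \<lfloor>fst p * real (Suc n)\<rfloor> / real (Suc n)"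
        by (rule divide_right_mono) simp
      then show "fst p - 1 / real (Suc n) \<le> real_of_int \<lfloor>fst p * real (Suc n)\<rfloor> / real (Suc n)"
        by (simp add: diff_divide_distrib del: of_nat_Suc)
    qed
    show "\<forall>\<^sub>F n in sequentially. real_of_int \<lfloor>fst p * real (Suc n)\<rfloor> / real (Suc n) \<le> fst p"
      by (rule always_eventually) (simp add: pos_divide_le_eq del: of_nat_Suc)
  qed simp
  moreover have "isCont (\<lambda>x. G x (snd p)) (fst p)"
    using cont[OF \<omega>] by (simp add: continuous_on_eq_continuous_at)
  ultimately show "(\<lambda>n. G (real_of_int \<lfloor>fst p * real (Suc n)\<rfloor> / real (Suc n)) (snd p)) \<longlonglongrightarrow> (case p of (x, \<omega>) \<Rightarrow> G x \<omega>)"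
    using isCont_tendsto_compose[of "fst p" "\<lambda>x. G x (snd p)"] by (simp add: case_prod_beta)
qed

text \<open>The set of continuous paths need not be measurable, so the field is set to zero on a measurable null set that
  contains its complement.\<close>

lemma continuous_modification:
  assumes G: "centered_gaussian_field P G" and cont: "AE \<omega> in P. continuous_on UNIV (\<lambda>x. G x \<omega>)"
  obtains G' where "centered_gaussian_field P G'" "\<And>\<omega>. continuous_on UNIV (\<lambda>x. G' x \<omega>)"
    "AE \<omega> in P. \<forall>x. G' x \<omega> = G x \<omega>"
proof -
  obtain N where N: "{\<omega> \<in> space P. \<not> continuous_on UNIV (\<lambda>x. G x \<omega>)} \<subseteq> N" "emeasure P N = 0" "N \<in> sets P"
    using AE_E[OF cont] .
  define G' where "G' x \<omega> = (if \<omega> \<in> space P - N then G x \<omega> else 0)" for x \<omega>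
  have meas[measurable]: "G x \<in> borel_measurable P" for x
    using G by (simp add: centered_gaussian_field_def)
  have [measurable]: "N \<in> sets P" by fact
  have meas'[measurable]: "G' x \<in> borel_measurable P" for x
    unfolding G'_def by measurable
  have "AE \<omega> in P. \<omega> \<notin> N" using N by (intro AE_not_in) (simp add: null_sets_def)
  then have ae: "AE \<omega> in P. \<forall>x. G' x \<omega> = G x \<omega>"
    using AE_space by eventually_elim (simp add: G'_def)
  have "distr P borel (\<lambda>\<omega>. \<Sum>x\<in>S. c x * G' x \<omega>) = distr P borel (\<lambda>\<omega>. \<Sum>x\<in>S. c x * G x \<omega>)" for S c
    by (rule distr_cong_AE) (use ae in auto)
  then have "centered_gaussian_field P G'"
    using G meas' by (simp add: centered_gaussian_field_def)
  moreover have "continuous_on UNIV (\<lambda>x. G' x \<omega>)" for \<omega>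
    using N(1) by (cases "\<omega> \<in> space P - N") (auto simp: G'_def)
  ultimately show ?thesis using ae that by blast
qed

lemma borel_measurable_completion_AE:
  fixes f g :: "'a \<Rightarrow> real"
  assumes g: "g \<in> borel_measurable M" and ae: "AE x in M. f x = g x"
  shows "f \<in> borel_measurable (completion M)"
proof (rule measurableI)
  fix A :: "real set" assume "A \<in> sets borel"
  then have 1: "g -` A \<inter> space (completion M) \<in> sets (completion M)"
    using measurable_completion[OF g] by (rule measurable_sets[rotated])
  have 2: "AE x in completion M. x \<in> g -` A \<inter> space (completion M) \<longleftrightarrow> x \<in> f -` A \<inter> space (completion M)"
    using AE_completion[OF ae] by eventually_elim simp
  show "f -` A \<inter> space (completion M) \<in> sets (completion M)"
    by (rule completion.in_sets_AE[OF 2 1]) simp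
qed simp

section \<open>Integrals of the correlation over the unit interval\<close>

definition row_const :: "real \<Rightarrow> real" where
  "row_const \<beta> = (if \<beta> = 1 then 2 else 2 / \<bar>1 - \<beta>\<bar>)"

text \<open>A primitive of \<open>t \<mapsto> (1 + t / \<epsilon>)\<^sup>-\<^sup>\<beta>\<close> on the half line.\<close>

definition decay_primitive :: "real \<Rightarrow> real \<Rightarrow> real \<Rightarrow> real" where
  "decay_primitive \<beta> \<epsilon> t = (if \<beta> = 1 then \<epsilon> * ln (1 + t / \<epsilon>) else \<epsilon> * (1 + t / \<epsilon>) powr (1 - \<beta>) / (1 - \<beta>))"

lemma decay_primitive_deriv:
  assumes "\<epsilon> > 0" "t \<ge> 0"
  shows "(decay_primitive \<beta> \<epsilon> has_real_derivative (1 + t / \<epsilon>) powr (- \<beta>)) (at t)"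
proof -
  have pos: "1 + t / \<epsilon> > 0" using assms by (simp add: add_pos_nonneg)
  show ?thesis
  proof (cases "\<beta> = 1")
    case True
    have "((\<lambda>t. \<epsilon> * ln (1 + t / \<epsilon>)) has_real_derivative (1 + t / \<epsilon>) powr (- 1)) (at t)"
      using assms pos by (auto intro!: derivative_eq_intros simp: powr_minus field_simps)
    then show ?thesis using True by (simp add: decay_primitive_def[abs_def])
  next
    case False
    have "((\<lambda>t. 1 + t / \<epsilon>) has_real_derivative 1 / \<epsilon>) (at t)"
      using assms by (auto intro!: derivative_eq_intros)
    from DERIV_cdivide[OF DERIV_cmult[OF DERIV_fun_powr[OF this pos, of "1 - \<beta>"], of \<epsilon>], of "1 - \<beta>"]
    have "((\<lambda>t. \<epsilon> * (1 + t / \<epsilon>) powr (1 - \<beta>) / (1 - \<beta>)) has_real_derivative (1 + t / \<epsilon>) powr (- \<beta>)) (at t)"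
      using assms False by simp
    then show ?thesis using False by (simp add: decay_primitive_def[abs_def])
  qed
qed

text \<open>For \<open>\<beta> < 1\<close> the upper end point dominates, through \<open>1 + 1/\<epsilon> \<le> 2/\<epsilon>\<close>; for \<open>\<beta> > 1\<close> the primitive is negative
  and its value at \<open>0\<close> dominates. For \<open>\<beta> = 1\<close> the condition \<open>\<epsilon> \<le> 1/2\<close> gives \<open>1 + 1/\<epsilon> \<le> \<epsilon>\<^sup>-\<^sup>2\<close>, hence a logarithm without
  additive constant.\<close>

lemma decay_primitive_le:
  assumes \<epsilon>: "0 < \<epsilon>" "\<epsilon> \<le> 1/2" and t: "0 \<le> t" "t \<le> 1" and \<beta>: "\<beta> > 0"
  shows "decay_primitive \<beta> \<epsilon> t - decay_primitive \<beta> \<epsilon> 0 \<le> row_const \<beta> * rate_sq \<beta> \<epsilon>"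
proof -
  have arg: "1 \<le> 1 + t / \<epsilon>" "1 + t / \<epsilon> \<le> 1 + 1 / \<epsilon>" using \<epsilon> t by (auto simp: divide_right_mono)
  consider "\<beta> < 1" | "\<beta> = 1" | "\<beta> > 1" by linarith
  then show ?thesis
  proof cases
    case 1
    have "1 \<le> 1 / \<epsilon>" "2 / \<epsilon> = 1 / \<epsilon> + 1 / \<epsilon>" using \<epsilon> by (auto simp: field_simps)
    then have "(1 + t / \<epsilon>) powr (1 - \<beta>) \<le> (2 / \<epsilon>) powr (1 - \<beta>)"
      using arg 1 by (intro powr_mono2) linarith+
    also have "\<dots> = 2 powr (1 - \<beta>) * \<epsilon> powr (\<beta> - 1)"
      using \<epsilon> by (simp add: powr_divide powr_diff)
    also have "\<dots> \<le> 2 powr 1 * \<epsilon> powr (\<beta> - 1)"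
      using \<beta> by (intro mult_right_mono powr_mono) auto
    finally have "(1 + t / \<epsilon>) powr (1 - \<beta>) \<le> 2 * \<epsilon> powr (\<beta> - 1)" by simp
    then have "\<epsilon> * (1 + t / \<epsilon>) powr (1 - \<beta>) \<le> \<epsilon> * (2 * \<epsilon> powr (\<beta> - 1))"
      using \<epsilon> by (intro mult_left_mono) auto
    also have "\<dots> = 2 * \<epsilon> powr \<beta>" using \<epsilon> by (simp add: powr_diff)
    finally have "\<epsilon> * (1 + t / \<epsilon>) powr (1 - \<beta>) / (1 - \<beta>) \<le> 2 * \<epsilon> powr \<beta> / (1 - \<beta>)"
      using 1 by (intro divide_right_mono) auto
    moreover have "\<epsilon> / (1 - \<beta>) \<ge> 0" using 1 \<epsilon> by simp
    ultimately have "\<epsilon> * (1 + t / \<epsilon>) powr (1 - \<beta>) / (1 - \<beta>) - \<epsilon> / (1 - \<beta>) \<le> 2 * \<epsilon> powr \<beta> / (1 - \<beta>)" by linarith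
    then show ?thesis using 1 by (simp add: decay_primitive_def row_const_def rate_sq_def)
  next
    case 2
    have "2 \<le> 1 / \<epsilon>" using \<epsilon> by (simp add: field_simps)
    moreover from this have "2 * (1 / \<epsilon>) \<le> (1 / \<epsilon>) * (1 / \<epsilon>)" by (rule mult_right_mono) (use \<epsilon> in simp)
    ultimately have "1 + 1 / \<epsilon> \<le> (1 / \<epsilon>) * (1 / \<epsilon>)" by linarith
    then have "ln (1 + t / \<epsilon>) \<le> ln ((1 / \<epsilon>) * (1 / \<epsilon>))" using arg \<epsilon> by (intro ln_mono) auto
    also have "\<dots> = 2 * \<bar>ln \<epsilon>\<bar>" using \<epsilon> by (simp add: ln_mult ln_div)
    finally have "\<epsilon> * ln (1 + t / \<epsilon>) \<le> \<epsilon> * (2 * \<bar>ln \<epsilon>\<bar>)" using \<epsilon> by (intro mult_left_mono) auto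
    then show ?thesis using 2 by (simp add: decay_primitive_def row_const_def rate_sq_def)
  next
    case 3
    have "0 \<le> \<epsilon> * (1 + t / \<epsilon>) powr (1 - \<beta>) / (\<beta> - 1)" using 3 \<epsilon> by simp
    moreover have "\<epsilon> / (\<beta> - 1) \<le> 2 * \<epsilon> / (\<beta> - 1)" using 3 \<epsilon> by (intro divide_right_mono) auto
    ultimately have "\<epsilon> / (\<beta> - 1) - \<epsilon> * (1 + t / \<epsilon>) powr (1 - \<beta>) / (\<beta> - 1) \<le> 2 * \<epsilon> / (\<beta> - 1)" by linarith
    moreover have "z / (1 - \<beta>) = - (z / (\<beta> - 1))" for z by (metis minus_diff_eq minus_divide_right)
    ultimately show ?thesis using 3 by (simp add: decay_primitive_def row_const_def rate_sq_def)
  qed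
qed

lemma decay_row_integral:
  assumes \<epsilon>: "0 < \<epsilon>" "\<epsilon> \<le> 1/2" and \<beta>: "\<beta> > 0"
  shows "(\<integral>x. (1 + \<bar>proj01 x - proj01 y\<bar> / \<epsilon>) powr (- \<beta>) \<partial>unit_uniform) \<le> 2 * row_const \<beta> * rate_sq \<beta> \<epsilon>"
proof -
  define w where "w = proj01 y"
  have w: "0 \<le> w" "w \<le> 1" using proj01_in[of y] by (auto simp: w_def)
  let ?k = "\<lambda>x. (1 + \<bar>x - w\<bar> / \<epsilon>) powr (- \<beta>)"
  let ?\<Phi> = "decay_primitive \<beta> \<epsilon>"
  have left: "(?k has_integral (- ?\<Phi> (w - w) - - ?\<Phi> (w - 0))) {0..w}"
  proof (rule fundamental_theorem_of_calculus)
    fix x assume x: "x \<in> {0..w}"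
    have 1: "(?\<Phi> has_real_derivative (1 + (w - x) / \<epsilon>) powr (- \<beta>)) (at (w - x))"
      using \<epsilon> x by (intro decay_primitive_deriv) auto
    have 2: "((\<lambda>x. w - x) has_real_derivative - 1) (at x)" by (auto intro!: derivative_eq_intros)
    have "((\<lambda>x. - ?\<Phi> (w - x)) has_real_derivative (1 + (w - x) / \<epsilon>) powr (- \<beta>)) (at x)"
      using DERIV_minus[OF DERIV_chain2[where f = ?\<Phi> and g = "\<lambda>x. w - x" and x = x, OF 1 2]] by simp
    moreover have "\<bar>x - w\<bar> = w - x" using x by simp
    ultimately show "((\<lambda>x. - ?\<Phi> (w - x)) has_vector_derivative ?k x) (at x within {0..w})"
      by (auto simp: has_real_derivative_iff_has_vector_derivative intro: has_vector_derivative_at_within)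
  qed (use w in simp)
  have right: "(?k has_integral (?\<Phi> (1 - w) - ?\<Phi> (w - w))) {w..1}"
  proof (rule fundamental_theorem_of_calculus)
    fix x assume x: "x \<in> {w..1}"
    have 1: "(?\<Phi> has_real_derivative (1 + (x - w) / \<epsilon>) powr (- \<beta>)) (at (x - w))"
      using \<epsilon> x by (intro decay_primitive_deriv) auto
    have 2: "((\<lambda>x. x - w) has_real_derivative 1) (at x)" by (auto intro!: derivative_eq_intros)
    have "((\<lambda>x. ?\<Phi> (x - w)) has_real_derivative (1 + (x - w) / \<epsilon>) powr (- \<beta>)) (at x)"
      using DERIV_chain2[where f = ?\<Phi> and g = "\<lambda>x. x - w" and x = x, OF 1 2] by simp
    moreover have "\<bar>x - w\<bar> = x - w" using x by simp
    ultimately show "((\<lambda>x. ?\<Phi> (x - w)) has_vector_derivative ?k x) (at x within {w..1})"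
      by (auto simp: has_real_derivative_iff_has_vector_derivative intro: has_vector_derivative_at_within)
  qed (use w in simp)
  have pos: "1 + \<bar>z\<bar> / \<epsilon> \<noteq> 0" for z using \<epsilon> by (smt (verit) abs_ge_zero divide_nonneg_pos)
  have "(\<integral>x. ?k (proj01 x) \<partial>unit_uniform) = integral {0..1} (\<lambda>x. ?k (proj01 x))"
    using pos \<epsilon> by (intro integral_unit_uniform_henstock continuous_intros continuous_proj01) auto
  also have "\<dots> = integral {0..1} ?k"
    by (rule Henstock_Kurzweil_Integration.integral_cong) (simp add: proj01_id)
  also have "\<dots> = (?\<Phi> w - ?\<Phi> 0) + (?\<Phi> (1 - w) - ?\<Phi> 0)"
    using integral_unique[OF has_integral_combine[OF w left right]] by simp
  also have "\<dots> \<le> 2 * row_const \<beta> * rate_sq \<beta> \<epsilon>"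
    using decay_primitive_le[OF \<epsilon> _ _ \<beta>, of w] decay_primitive_le[OF \<epsilon> _ _ \<beta>, of "1 - w"] w by simp
  finally show ?thesis by (simp add: w_def)
qed

section \<open>The variance estimate\<close>

text \<open>The covariance is measurable because it is an expectation of the jointly measurable field.\<close>

lemma lognormal_weight_rescaled_field:
  fixes G :: "real \<Rightarrow> 'w \<Rightarrow> real"
  assumes P: "prob_space P" and G: "centered_gaussian_field P G"
    and cont: "\<And>\<omega>. continuous_on UNIV (\<lambda>x. G x \<omega>)"
    and cov: "\<And>x y. (\<integral>\<omega>. G x \<omega> * G y \<omega> \<partial>P) = C (x - y)"
    and C_le: "\<And>x. \<bar>C x\<bar> \<le> K * (1 + \<bar>x\<bar>) powr (- \<beta>)"
    and \<beta>: "0 < \<beta>" and \<epsilon>: "0 < \<epsilon>" "\<epsilon> \<le> 1/2"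
  shows "lognormal_weight P unit_uniform (\<lambda>x. G (proj01 x / \<epsilon>)) (\<lambda>x y. C (proj01 x / \<epsilon> - proj01 y / \<epsilon>))
           (C 0) K (K * (2 * row_const \<beta> * rate_sq \<beta> \<epsilon>))"
proof -
  interpret P: prob_space P by fact
  interpret U: prob_space unit_uniform by (rule prob_space_unit_uniform)
  have [measurable]: "G x \<in> borel_measurable P" for x
    using G by (simp add: centered_gaussian_field_def)
  have joint: "(\<lambda>(x, \<omega>). G x \<omega>) \<in> borel_measurable (borel \<Otimes>\<^sub>M P)"
    by (rule measurable_continuous_field) (simp_all add: cont)
  have [measurable]: "C \<in> borel_measurable borel"
  proof -
    have "(\<lambda>(x, \<omega>). G x \<omega> * G 0 \<omega>) \<in> borel_measurable (borel \<Otimes>\<^sub>M P)"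
      using joint by measurable
    then have "(\<lambda>x. \<integral>\<omega>. G x \<omega> * G 0 \<omega> \<partial>P) \<in> borel_measurable borel"
      by (rule P.borel_measurable_lebesgue_integral)
    then show ?thesis by (simp add: cov)
  qed
  have K: "K \<ge> 0" using C_le[of 0] by simp
  have C_le_K: "\<bar>C x\<bar> \<le> K" for x
  proof -
    have "(1 + \<bar>x\<bar>) powr (- \<beta>) \<le> 1"
      using powr_mono[of "- \<beta>" 0 "1 + \<bar>x\<bar>"] \<beta> by (simp split: if_splits)
    then have "K * (1 + \<bar>x\<bar>) powr (- \<beta>) \<le> K * 1" using K by (intro mult_left_mono) auto
    with C_le[of x] show ?thesis by linarith
  qed
  show ?thesis
  proof (rule lognormal_weight.intro, fact, rule prob_space_unit_uniform, unfold_locales)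
    show "(\<lambda>(x, \<omega>). G (proj01 x / \<epsilon>) \<omega>) \<in> borel_measurable (unit_uniform \<Otimes>\<^sub>M P)"
    proof -
      have "(\<lambda>p. (proj01 (fst p) / \<epsilon>, snd p)) \<in> measurable (unit_uniform \<Otimes>\<^sub>M P) (borel \<Otimes>\<^sub>M P)"
        by measurable
      from measurable_compose[OF this joint] show ?thesis by (simp add: case_prod_beta)
    qed
    show "\<exists>B. \<forall>x. \<bar>G (proj01 x / \<epsilon>) \<omega>\<bar> \<le> B" for \<omega>
    proof -
      have "continuous_on {0..1} (\<lambda>y. G (y / \<epsilon>) \<omega>)"
        using \<epsilon> by (intro continuous_on_compose2[OF cont] continuous_intros) auto
      from bounded_mble_bound[OF bounded_mble_proj01[OF this]] show ?thesis by blast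
    qed
    show "has_bochner_integral P (\<lambda>\<omega>. exp (\<Sum>i\<in>I. a i * G (proj01 (p i) / \<epsilon>) \<omega>))
       (exp ((\<Sum>i\<in>I. \<Sum>j\<in>I. a i * a j * C (proj01 (p i) / \<epsilon> - proj01 (p j) / \<epsilon>)) / 2))"
      if "finite I" for I :: "nat set" and a p
      by (rule gaussian_field_exp_moment[OF G _ that, where p = "\<lambda>i. proj01 (p i) / \<epsilon>" and R = "\<lambda>x y. C (x - y)"]) (rule cov)
    show "(\<lambda>(x, y). C (proj01 x / \<epsilon> - proj01 y / \<epsilon>)) \<in> borel_measurable (unit_uniform \<Otimes>\<^sub>M unit_uniform)"
      by measurable
    show "C (proj01 x / \<epsilon> - proj01 y / \<epsilon>) = C (proj01 y / \<epsilon> - proj01 x / \<epsilon>)" for x y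
      by (simp add: mult.commute flip: cov)
    show "(\<integral>x. \<bar>C (proj01 x / \<epsilon> - proj01 y / \<epsilon>)\<bar> \<partial>unit_uniform) \<le> K * (2 * row_const \<beta> * rate_sq \<beta> \<epsilon>)" for y
    proof -
      have le: "\<bar>C (proj01 x / \<epsilon> - proj01 y / \<epsilon>)\<bar> \<le> K * (1 + \<bar>proj01 x - proj01 y\<bar> / \<epsilon>) powr (- \<beta>)" for x
        using C_le[of "proj01 x / \<epsilon> - proj01 y / \<epsilon>"] \<epsilon> by (simp flip: diff_divide_distrib)
      have le1: "(1 + \<bar>proj01 x - proj01 y\<bar> / \<epsilon>) powr (- \<beta>) \<le> 1" for x
        using powr_mono[of "- \<beta>" 0 "1 + \<bar>proj01 x - proj01 y\<bar> / \<epsilon>"] \<beta> \<epsilon> by (simp split: if_splits)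
      have "integrable unit_uniform (\<lambda>x. \<bar>C (proj01 x / \<epsilon> - proj01 y / \<epsilon>)\<bar>)"
        by (rule U.integrable_const_bound[where B = K]) (use C_le_K in auto)
      moreover have "integrable unit_uniform (\<lambda>x. (1 + \<bar>proj01 x - proj01 y\<bar> / \<epsilon>) powr (- \<beta>))"
        by (rule U.integrable_const_bound[where B = 1]) (use le1 in auto)
      ultimately have "(\<integral>x. \<bar>C (proj01 x / \<epsilon> - proj01 y / \<epsilon>)\<bar> \<partial>unit_uniform)
          \<le> (\<integral>x. K * (1 + \<bar>proj01 x - proj01 y\<bar> / \<epsilon>) powr (- \<beta>) \<partial>unit_uniform)"
        using le by (intro integral_mono) auto
      also have "\<dots> = K * (\<integral>x. (1 + \<bar>proj01 x - proj01 y\<bar> / \<epsilon>) powr (- \<beta>) \<partial>unit_uniform)" by simp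
      also have "\<dots> \<le> K * (2 * row_const \<beta> * rate_sq \<beta> \<epsilon>)"
        by (intro mult_left_mono decay_row_integral \<epsilon> \<beta> K)
      finally show ?thesis .
    qed
  qed (use C_le_K in auto)
qed

theorem theorem5p1:
  fixes P :: "'w measure"
    and G :: "real \<Rightarrow> 'w \<Rightarrow> real"
    and C C0 :: "real \<Rightarrow> real"
    and \<beta> K :: real
  assumes "prob_space P"
    and "0 < \<beta>"
    and "centered_gaussian_field P G"
    and "\<And>x y. (\<integral>\<omega>. G x \<omega> * G y \<omega> \<partial>P) = C (x - y)"
    and "AE \<omega> in P. continuous_on UNIV (\<lambda>x. G x \<omega>)"
    and "holder_at_zero C"
    and "\<And>x. \<bar>C x\<bar> \<le> K * (1 + \<bar>x\<bar>) powr (- \<beta>)"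
    and "C0 \<in> borel_measurable lebesgue"
    and "\<And>x. C x = convolution_fun C0 C0 x"
    and "\<And>x. (SUP y\<in>ball x 1. ereal \<bar>C0 y\<bar>)
               \<le> ereal (K * (1 + \<bar>x\<bar>) powr (- (1 + \<beta>) / 2) * log_correction \<beta> x)"
  shows "\<exists>M::real. \<forall>\<epsilon>\<in>{0<..1/2}. \<forall>f g. \<forall>u :: 'w \<Rightarrow> real \<Rightarrow> real.
           C1_unit_interval f \<longrightarrow> C1_unit_interval g \<longrightarrow>
           (AE \<omega> in P. dirichlet_solution (\<lambda>x. exp (G (x / \<epsilon>) \<omega>)) f (u \<omega>)) \<longrightarrow>
             (\<lambda>\<omega>. I_functional (u \<omega>) g) \<in> borel_measurable (completion P) \<and>
             integrable (completion P) (\<lambda>\<omega>. (I_functional (u \<omega>) g)\<^sup>2) \<and>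
             prob_space.variance (completion P) (\<lambda>\<omega>. I_functional (u \<omega>) g)
               \<le> M * (L4_norm f)\<^sup>2 * (L4_norm g)\<^sup>2 * rate_sq \<beta> \<epsilon>"
proof -
  interpret P: prob_space P by fact
  obtain G' where G': "centered_gaussian_field P G'" "\<And>\<omega>. continuous_on UNIV (\<lambda>x. G' x \<omega>)"
    and ae: "AE \<omega> in P. \<forall>x. G' x \<omega> = G x \<omega>"
    using continuous_modification[OF assms(3,5)] by blast
  have meas: "G x \<in> borel_measurable P" "G' x \<in> borel_measurable P" for x
    using assms(3) G'(1) by (auto simp: centered_gaussian_field_def)
  have cov: "(\<integral>\<omega>. G' x \<omega> * G' y \<omega> \<partial>P) = C (x - y)" for x y
  proof -
    have "(\<integral>\<omega>. G' x \<omega> * G' y \<omega> \<partial>P) = (\<integral>\<omega>. G x \<omega> * G y \<omega> \<partial>P)"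
      by (rule integral_cong_AE) (use meas ae in auto)
    then show ?thesis using assms(4) by simp
  qed
  define M where "M = 128 * (2 * exp (8 * K)) * (K * (2 * row_const \<beta>))"
  show ?thesis
  proof (rule exI[of _ M], intro ballI allI impI)
    fix \<epsilon> :: real and f g and u :: "'w \<Rightarrow> real \<Rightarrow> real"
    assume \<epsilon>: "\<epsilon> \<in> {0<..1/2}" and f: "C1_unit_interval f" and g: "C1_unit_interval g"
      and u: "AE \<omega> in P. dirichlet_solution (\<lambda>x. exp (G (x / \<epsilon>) \<omega>)) f (u \<omega>)"
    interpret W: lognormal_weight P unit_uniform "\<lambda>x. G' (proj01 x / \<epsilon>)"
      "\<lambda>x y. C (proj01 x / \<epsilon> - proj01 y / \<epsilon>)" "C 0" K "K * (2 * row_const \<beta> * rate_sq \<beta> \<epsilon>)"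
      using \<epsilon> by (intro lognormal_weight_rescaled_field assms(1,2,7) G' cov) auto
    define F H where "F = (\<lambda>x. f (proj01 x))" and "H = (\<lambda>x. g (proj01 x))"
    have cf: "continuous_on {0..1} f" "continuous_on {0..1} g"
      using f g by (auto intro: C1_unit_interval_continuous)
    have b: "bounded_mble unit_uniform F" "bounded_mble unit_uniform H"
      unfolding F_def H_def by (intro bounded_mble_proj01 cf)+
    let ?I = "\<lambda>\<omega>. I_functional (u \<omega>) g" and ?J = "W.weighted_cov F H"
    have IJ: "AE \<omega> in P. ?I \<omega> = ?J \<omega>"
      using u ae
    proof eventually_elim
      case (elim \<omega>)
      then have "dirichlet_solution (\<lambda>x. exp (G' (x / \<epsilon>) \<omega>)) f (u \<omega>)" by simp
      moreover have "continuous_on UNIV (\<lambda>x. exp (G' (x / \<epsilon>) \<omega>))"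
        using \<epsilon> by (intro continuous_on_exp continuous_on_compose2[OF G'(2)] continuous_intros) auto
      ultimately show ?case
        using dirichlet_I_functional[of "\<lambda>x. exp (G' (x / \<epsilon>) \<omega>)" f g "u \<omega>"] f g
        by (simp add: W.weighted_cov_def W.b_def F_def H_def exp_minus inverse_eq_divide)
    qed
    have J: "?J \<in> borel_measurable P" by (intro W.weighted_cov_measurable b)
    note J' = measurable_completion[OF J]
    have I: "?I \<in> borel_measurable (completion P)"
      by (rule borel_measurable_completion_AE[OF J IJ])
    note IJ' = AE_completion[OF IJ]
    have "integrable (completion P) (\<lambda>\<omega>. (?J \<omega>)\<^sup>2)"
      using W.weighted_cov_variance(1)[OF b] J by (simp add: integrable_completion)
    then have "integrable (completion P) (\<lambda>\<omega>. (?I \<omega>)\<^sup>2)"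
      by (rule integrable_cong_AE_imp) (use I IJ' in auto)
    moreover have "prob_space.variance (completion P) ?I
        \<le> M * (L4_norm f)\<^sup>2 * (L4_norm g)\<^sup>2 * rate_sq \<beta> \<epsilon>"
    proof -
      have mean: "(\<integral>\<omega>. ?I \<omega> \<partial>completion P) = (\<integral>\<omega>. ?J \<omega> \<partial>P)"
        using integral_cong_AE[OF I J' IJ'] J by (simp add: integral_completion)
      have "prob_space.variance (completion P) ?I
          = (\<integral>\<omega>. (?J \<omega> - (\<integral>\<omega>. ?J \<omega> \<partial>P))\<^sup>2 \<partial>completion P)"
        unfolding mean by (rule integral_cong_AE) (use I J' IJ' in auto)
      also have "\<dots> = P.variance ?J"
        using J by (intro integral_completion) simp
      also have "\<dots> \<le> 128 * W.L * (K * (2 * row_const \<beta> * rate_sq \<beta> \<epsilon>))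
          * sqrt ((\<integral>x. (F x) ^ 4 \<partial>unit_uniform) * (\<integral>x. (H x) ^ 4 \<partial>unit_uniform))"
        by (rule W.weighted_cov_variance(2)[OF b])
      also have "\<dots> = M * (L4_norm f)\<^sup>2 * (L4_norm g)\<^sup>2 * rate_sq \<beta> \<epsilon>"
        by (simp add: M_def W.L_def F_def H_def L4_norm_square[OF cf(1)] L4_norm_square[OF cf(2)] real_sqrt_mult)
      finally show ?thesis .
    qed
    ultimately show "?I \<in> borel_measurable (completion P) \<and>
        integrable (completion P) (\<lambda>\<omega>. (?I \<omega>)\<^sup>2) \<and>
        prob_space.variance (completion P) ?I \<le> M * (L4_norm f)\<^sup>2 * (L4_norm g)\<^sup>2 * rate_sq \<beta> \<epsilon>"
      using I by blast
  qed
qed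

end
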